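(* Let $N$ be an even hyperbolic lattice and $f \in O(N)$ an isometry whose characteristic polynomial is a Salem polynomial $s(x)$. If $$|\det N| > 4\, |\mathrm{discr}\, s(x)|,$$ then $f$ preserves a chamber of the positive cone of $N$, i.e. $f$ maps some chamber of $N$ to itself.
   Context: A lattice is a finitely generated free abelian group $L$ with a non-degenerate symmetric integer-valued bilinear form $\langle\cdot,\cdot\rangle$; write $x.y = \langle x,y\rangle$ and $x^2 = \langle x,x\rangle$. It is even if $x^2 \in 2\mathbb{Z}$ for all $x \in L$. Its determinant is the determinant of a Gram matrix. It is hyperbolic if it is indefinite and its signature is $(1, \mathrm{rk}\, L - 1)$ (exactly one positive eigenvalue of the Gram matrix). $O(L)$ is the group of self-isometries of $L$. A Salem number is a real algebraic integer $\lambda>1$ Galois conjugate to $1/\lambda$ and all of whose other conjugates lie on the unit circle (degree $2$ is allowed); a Salem polynomial is the minimal polynomial over $\mathbb{Q}$ of a Salem number. $\mathrm{discr}\, s(x)$ is the discriminant of the polynomial $s$. A root of an even lattice $L$ is an $r \in L$ with $r^2 = -2$; $\Delta_L$ is the set of roots. For $L$ hyperbolic, $V_L = \{x \in L \otimes \mathbb{R} \mid x^2 > 0,\ r.x \neq 0 \text{ for all } r \in \Delta_L\}$, an open set; its connected components are called chambers (of the positive cone). *)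

theory Defs
  imports "HOL-Analysis.Analysis" "Jordan_Normal_Form.Char_Poly"
begin

section \<open>Lattices\<close>

text \<open>
  A lattice \<open>L\<close> of rank \<open>n\<close> is realised as the \<open>\<int>\<close>-span of a basis of an \<open>n\<close>-dimensional real
  vector space \<open>'v\<close>, so that \<open>'v\<close> is \<open>L \<otimes> \<real>\<close>. The form of the lattice is a real bilinear form
  \<open>B\<close> on \<open>'v\<close> that is integral on \<open>L\<close>, i.e. the \<open>\<real>\<close>-bilinear extension of the form on \<open>L\<close>. It is
  unrelated to the inner product of the type class \<open>euclidean_space\<close>, which only supplies the
  (canonical) topology of a finite-dimensional real vector space.
\<close>

definition lattice_basis :: "'v::euclidean_space set \<Rightarrow> 'v list \<Rightarrow> bool" where
  "lattice_basis L bs \<longleftrightarrow>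
     distinct bs \<and> independent (set bs) \<and> span (set bs) = UNIV \<and>
     L = range (\<lambda>c :: nat \<Rightarrow> int. \<Sum>i<length bs. of_int (c i) *\<^sub>R bs ! i)"

definition integral_lattice ::
    "'v::euclidean_space set \<Rightarrow> ('v \<Rightarrow> 'v \<Rightarrow> real) \<Rightarrow> bool" where
  "integral_lattice L B \<longleftrightarrow>
     (\<exists>bs. lattice_basis L bs) \<and> bilinear B \<and> (\<forall>x y. B x y = B y x) \<and>
     (\<forall>x\<in>L. \<forall>y\<in>L. B x y \<in> \<int>) \<and>
     (\<forall>x\<in>L. (\<forall>y\<in>L. B x y = 0) \<longrightarrow> x = 0)"

definition even_lattice :: "'v::euclidean_space set \<Rightarrow> ('v \<Rightarrow> 'v \<Rightarrow> real) \<Rightarrow> bool" where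
  "even_lattice L B \<longleftrightarrow> integral_lattice L B \<and> (\<forall>x\<in>L. \<exists>k::int. B x x = of_int (2 * k))"

definition gram_matrix :: "('v \<Rightarrow> 'v \<Rightarrow> real) \<Rightarrow> 'v list \<Rightarrow> real mat" where
  "gram_matrix B bs = mat (length bs) (length bs) (\<lambda>(i, j). B (bs ! i) (bs ! j))"

text \<open>The numbers of positive and of negative eigenvalues, counted with multiplicity.\<close>

definition signature :: "real mat \<Rightarrow> nat \<times> nat" where
  "signature A =
     (size {#x \<in># proots (char_poly A). x > 0#}, size {#x \<in># proots (char_poly A). x < 0#})"

definition indefinite :: "'v::euclidean_space set \<Rightarrow> ('v \<Rightarrow> 'v \<Rightarrow> real) \<Rightarrow> bool" where
  "indefinite L B \<longleftrightarrow> (\<exists>x\<in>L. B x x > 0) \<and> (\<exists>x\<in>L. B x x < 0)"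

text \<open>By Sylvester's law of inertia the choice of \<open>bs\<close> is immaterial.\<close>

definition hyperbolic_lattice ::
    "'v::euclidean_space set \<Rightarrow> ('v \<Rightarrow> 'v \<Rightarrow> real) \<Rightarrow> bool" where
  "hyperbolic_lattice L B \<longleftrightarrow>
     integral_lattice L B \<and> indefinite L B \<and>
     (\<exists>bs. lattice_basis L bs \<and> signature (gram_matrix B bs) = (1, length bs - 1))"

text \<open>An element of \<open>O(L)\<close>, identified with its \<open>\<real>\<close>-linear extension to \<open>L \<otimes> \<real>\<close>.\<close>

definition lattice_isometry ::
    "'v::euclidean_space set \<Rightarrow> ('v \<Rightarrow> 'v \<Rightarrow> real) \<Rightarrow> ('v \<Rightarrow> 'v) \<Rightarrow> bool" where
  "lattice_isometry L B f \<longleftrightarrow>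
     linear f \<and> bij_betw f L L \<and> (\<forall>x\<in>L. \<forall>y\<in>L. B (f x) (f y) = B x y)"

text \<open>Column \<open>j\<close> holds the coordinates of \<open>f (bs ! j)\<close> in the basis \<open>bs\<close>.\<close>

definition matrix_wrt :: "'v::euclidean_space list \<Rightarrow> ('v \<Rightarrow> 'v) \<Rightarrow> real mat" where
  "matrix_wrt bs f =
     mat (length bs) (length bs) (\<lambda>(i, j). representation (set bs) (f (bs ! j)) (bs ! i))"

section \<open>Roots and chambers\<close>

definition lattice_roots :: "'v::euclidean_space set \<Rightarrow> ('v \<Rightarrow> 'v \<Rightarrow> real) \<Rightarrow> 'v set" where
  "lattice_roots L B = {r \<in> L. B r r = -2}"

definition chambers :: "'v::euclidean_space set \<Rightarrow> ('v \<Rightarrow> 'v \<Rightarrow> real) \<Rightarrow> 'v set set" where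
  "chambers L B = components {x. B x x > 0 \<and> (\<forall>r\<in>lattice_roots L B. B r x \<noteq> 0)}"

section \<open>Salem polynomials and discriminants\<close>

text \<open>\<open>p\<close> is the monic generator of the ideal of rational polynomials vanishing at \<open>x\<close>.\<close>

definition minimal_polynomial :: "complex \<Rightarrow> rat poly \<Rightarrow> bool" where
  "minimal_polynomial x p \<longleftrightarrow>
     lead_coeff p = 1 \<and> (\<forall>q. poly (map_poly of_rat q) x = 0 \<longleftrightarrow> p dvd q)"

definition galois_conjugate :: "complex \<Rightarrow> complex \<Rightarrow> bool" where
  "galois_conjugate x y \<longleftrightarrow>
     (\<exists>p. minimal_polynomial x p \<and> poly (map_poly of_rat p) y = 0)"

definition salem_number :: "real \<Rightarrow> bool" where
  "salem_number l \<longleftrightarrow>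
     l > 1 \<and> algebraic_int l \<and> galois_conjugate (of_real l) (of_real (1 / l)) \<and>
     (\<forall>z. galois_conjugate (of_real l) z \<and> z \<noteq> of_real l \<and> z \<noteq> of_real (1 / l) \<longrightarrow> norm z = 1)"

definition salem_polynomial :: "rat poly \<Rightarrow> bool" where
  "salem_polynomial p \<longleftrightarrow> (\<exists>l. salem_number l \<and> minimal_polynomial (of_real l) p)"

text \<open>
  For roots \<open>\<alpha>\<^sub>1, \<dots>, \<alpha>\<^sub>n\<close> listed with multiplicity, the discriminant is
  \<open>c\<^bsup>2n-2\<^esup> * (\<Prod>i<j. (\<alpha>\<^sub>i - \<alpha>\<^sub>j)\<^sup>2)\<close>, with \<open>c\<close> the leading coefficient. The product below runs over
  ordered pairs \<open>i \<noteq> j\<close> instead, which accounts for the sign.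
\<close>

definition discr :: "rat poly \<Rightarrow> complex" where
  "discr p =
     (let n = degree p; R = proots (map_poly of_rat p :: complex poly) in
        (-1) ^ (n * (n - 1) div 2) * of_rat (lead_coeff p) ^ (2 * n - 2) *
        (\<Prod>a\<in>#R. \<Prod>b\<in>#R - {#a#}. a - b))"

end

theory Submission
  imports Defs "Jordan_Normal_Form.Schur_Decomposition" "HOL-Computational_Algebra.Field_as_Ring"
begin

text \<open>
  Let \<open>l\<close> be the Salem number, and let \<open>v\<close> and \<open>w\<close> be eigenvectors of \<open>f\<close> for \<open>l\<close> and \<open>1 / l\<close>. Both
  are isotropic, and the signature forces \<open>B v w \<noteq> 0\<close>, so that, after a change of sign, the open cone
  \<open>{a v + b w | a, b > 0}\<close> (the axis of \<open>f\<close>) consists of vectors of positive norm. It is convex and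
  \<open>f\<close> maps it to itself. If no hyperplane orthogonal to a root meets the axis, then the axis lies in
  one chamber, and \<open>f\<close> preserves that chamber (\<open>chamber_through_axis\<close>). A root \<open>r\<close> whose hyperplane
  misses the axis is one with \<open>B r v * B r w > 0\<close>. What has to be shown is that a root violating this
  inequality forces \<open>\<bar>det N\<bar> \<le> \<bar>discr s\<bar>\<close> (\<open>root_does_not_separate_axis\<close>).

  Let \<open>r\<close> be such a root and decompose it over the complex numbers into eigenvectors \<open>r\<^sub>a\<close>, where \<open>a\<close>
  runs through the roots of \<open>s\<close>. Put \<open>c\<^sub>a = B r\<^sub>a r = B r\<^sub>a r\<^bsub>1/a\<^esub>\<close>. These numbers have sum
  \<open>B r r = -2\<close>. If \<open>a\<close> lies on the unit circle, then \<open>c\<^sub>a\<close> is the value of the Hermitian extension of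
  the form at \<open>r\<^sub>a\<close>, and \<open>r\<^sub>a\<close> is orthogonal to \<open>v + w\<close>, so \<open>c\<^sub>a \<le> 0\<close>. For the other two roots
  \<open>c\<^sub>a = B r v * B r w / B v w\<close>, which is at most \<open>0\<close> by the choice of \<open>r\<close>. Non-positive numbers with sum
  \<open>-2\<close>, at least two in number, have a product of absolute value at most \<open>1\<close>
  (\<open>prod_coefficients_le_1\<close>).

  Now let \<open>n\<close> be the rank. The Gram matrix of \<open>r, f r, \<dots>, f\<^bsup>n-1\<^esup> r\<close> has the entries
  \<open>\<Sum>\<^sub>a c\<^sub>a a\<^bsup>i-j\<^esup>\<close>, hence is a product of a Vandermonde matrix, a diagonal matrix and another
  Vandermonde matrix, and its determinant has the absolute value \<open>\<bar>discr s\<bar> * \<Prod>\<^sub>a \<bar>c\<^sub>a\<bar> \<le> \<bar>discr s\<bar>\<close>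
  (\<open>norm_det_orbit_gram\<close>). It is not \<open>0\<close>, since \<open>s\<close> is irreducible over the rationals and no \<open>c\<^sub>a\<close>
  vanishes (\<open>coefficient_nonzero\<close>). As the \<open>f\<^bsup>i\<^esup> r\<close> lie in \<open>N\<close>, it is also \<open>det N\<close> times the square
  of an integer (\<open>sublattice_gram\<close>). Thus \<open>\<bar>det N\<bar> \<le> \<bar>discr s\<bar>\<close>.
\<close>

section \<open>Vandermonde determinants\<close>

lemma index_mult_mat_sum:
  assumes "A \<in> carrier_mat n m" "C \<in> carrier_mat m l" "i < n" "j < l"
  shows "(A * C) $$ (i, j) = (\<Sum>k<m. A $$ (i, k) * C $$ (k, j))"
  using assms by (simp add: scalar_prod_def atLeast0LessThan)

text \<open>
  Horner's scheme: the coefficients of the quotient by a linear factor are the partial evaluations at its root.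
\<close>

lemma coeff_linear_quotient:
  fixes p q :: "'a::comm_ring_1 poly"
  assumes p: "p = [:- a, 1:] * q" and deg: "degree q < n" and "i \<le> n"
  shows "coeff q i = (\<Sum>j=i..<n. coeff p (Suc j) * a ^ (j - i))"
proof -
  have step: "coeff p (Suc j) = coeff q j - a * coeff q (Suc j)" for j
    unfolding p by simp
  have "coeff p (Suc j) * a ^ (j - i)
      = a ^ (j - i) * coeff q j - a ^ (Suc j - i) * coeff q (Suc j)" if "i \<le> j" for j
    unfolding step using that by (simp add: algebra_simps Suc_diff_le)
  then have "(\<Sum>j=i..<n. coeff p (Suc j) * a ^ (j - i))
      = (\<Sum>j=i..<n. a ^ (j - i) * coeff q j - a ^ (Suc j - i) * coeff q (Suc j))"
    by (intro sum.cong) auto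
  also have "\<dots> = - (\<Sum>j=i..<n. a ^ (Suc j - i) * coeff q (Suc j) - a ^ (j - i) * coeff q j)"
    unfolding sum_negf[symmetric] by simp
  also have "\<dots> = - (a ^ (n - i) * coeff q n - a ^ (i - i) * coeff q i)"
    by (subst sum_Suc_diff'[OF \<open>i \<le> n\<close>]) auto
  also have "\<dots> = coeff q i"
    using coeff_eq_0[OF deg] by simp
  finally show ?thesis by simp
qed

lemma monic_prod_linear:
  fixes x :: "'b \<Rightarrow> 'a::idom"
  assumes "finite A"
  shows "degree (\<Prod>k\<in>A. [:- x k, 1:]) = card A" "lead_coeff (\<Prod>k\<in>A. [:- x k, 1:]) = 1"
proof -
  show "degree (\<Prod>k\<in>A. [:- x k, 1:]) = card A"
    using assms by (subst degree_prod_eq_sum_degree) auto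
  show "lead_coeff (\<Prod>k\<in>A. [:- x k, 1:]) = 1"
    by (subst lead_coeff_prod) simp
qed

text \<open>
  For \<open>p = \<Prod>\<^sub>l (X - x\<^sub>l)\<close> and \<open>q\<^sub>k = p / (X - x\<^sub>k)\<close>, let \<open>Q\<close> be the matrix whose row \<open>k\<close> holds the
  coefficients of \<open>q\<^sub>k\<close>. Then \<open>Q V\<close> evaluates each \<open>q\<^sub>k\<close> at each \<open>x\<^sub>l\<close>, hence is diagonal with the entries
  \<open>q\<^sub>k(x\<^sub>k)\<close>. On the other hand Horner's scheme says that \<open>Q = W S\<close>, where \<open>S\<close> is triangular, contains
  coefficients of \<open>p\<close>, and has the leading coefficient \<open>1\<close> on its diagonal. With the exponents of \<open>W\<close> in
  descending order no sign appears.
\<close>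

lemma det_vandermonde_product:
  fixes x :: "nat \<Rightarrow> 'a::{idom,ring_char_0}" and n :: nat
  defines "V \<equiv> mat n n (\<lambda>(i, k). x k ^ i)"
    and "W \<equiv> mat n n (\<lambda>(k, j). x k ^ (n - 1 - j))"
  shows "Determinant.det V * Determinant.det W = (\<Prod>k<n. \<Prod>l\<in>{..<n}-{k}. x k - x l)"
proof -
  define p where "p = (\<Prod>l<n. [:- x l, 1:])"
  define q where "q k = (\<Prod>l\<in>{..<n}-{k}. [:- x l, 1:])" for k
  \<comment> \<open>The matrix that expresses Horner's scheme; it is lower triangular with ones on the diagonal.\<close>
  define S where "S = mat n n (\<lambda>(l, i). if i \<le> l then coeff p (n - l + i) else 0)"
  define Q where "Q = mat n n (\<lambda>(k, i). coeff (q k) i)"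
  have p: "degree p = n" "coeff p n = 1"
    using monic_prod_linear[of "{..<n}" x] by (simp_all add: p_def)
  have q: "degree (q k) < n" "p = [:- x k, 1:] * q k" if "k < n" for k
  proof -
    show "degree (q k) < n"
      unfolding q_def using that by (subst monic_prod_linear) auto
    show "p = [:- x k, 1:] * q k"
      unfolding p_def q_def using that by (intro prod.remove) auto
  qed
  have carr: "V \<in> carrier_mat n n" "W \<in> carrier_mat n n" "S \<in> carrier_mat n n" "Q \<in> carrier_mat n n"
    by (auto simp: V_def W_def S_def Q_def)
  have "Q = W * S"
  proof (rule eq_matI)
    fix k i assume "k < dim_row (W * S)" "i < dim_col (W * S)"
    then have ki: "k < n" "i < n" using carr by auto
    have "(W * S) $$ (k, i) = (\<Sum>l<n. W $$ (k, l) * S $$ (l, i))"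
      using ki carr by (intro index_mult_mat_sum)
    also have "\<dots> = (\<Sum>l<n. if i \<le> l then x k ^ (n - 1 - l) * coeff p (n - l + i) else 0)"
      using ki by (intro sum.cong) (auto simp: W_def S_def)
    also have "\<dots> = (\<Sum>l=i..<n. x k ^ (n - 1 - l) * coeff p (n - l + i))"
      by (simp add: sum.If_cases) (intro sum.cong, auto)
    also have "\<dots> = (\<Sum>j=i..<n. coeff p (Suc j) * x k ^ (j - i))"
      by (rule sum.reindex_bij_witness[of _ "\<lambda>j. n - 1 - j + i" "\<lambda>l. n - 1 - l + i"])
         (auto simp: algebra_simps Suc_diff_le intro!: arg_cong2[where f = "(*)"] arg_cong[where f = "coeff p"])
    also have "\<dots> = coeff (q k) i"
      using coeff_linear_quotient[OF q(2)[OF ki(1)] q(1)[OF ki(1)], of i] ki by simp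
    finally show "Q $$ (k, i) = (W * S) $$ (k, i)"
      using ki by (simp add: Q_def)
  qed (use carr in auto)
  moreover have "Determinant.det S = 1"
  proof -
    have "Determinant.det S = prod_list (diag_mat S)"
      by (rule det_lower_triangular[OF _ carr(3)]) (auto simp: S_def)
    also have "\<dots> = 1"
      unfolding prod_list_diag_prod using p(2) by (intro prod.neutral) (auto simp: S_def)
    finally show ?thesis .
  qed
  ultimately have detQ: "Determinant.det Q = Determinant.det W"
    using carr by (simp add: det_mult)
  have QV: "Q * V = mat n n (\<lambda>(k, l). if k = l then (\<Prod>l\<in>{..<n}-{k}. x k - x l) else 0)"
    (is "_ = ?D")
  proof (rule eq_matI)
    fix k l assume "k < dim_row ?D" "l < dim_col ?D"
    then have kl: "k < n" "l < n" by auto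
    have "row Q k \<bullet> col V l = (\<Sum>i<n. coeff (q k) i * x l ^ i)"
      using kl carr by (simp add: scalar_prod_def atLeast0LessThan Q_def V_def)
    also have "\<dots> = poly (q k) (x l)"
      unfolding poly_altdef using q(1)[OF kl(1)]
      by (intro sum.mono_neutral_right) (auto simp: coeff_eq_0)
    also have "\<dots> = (\<Prod>m\<in>{..<n}-{k}. x l - x m)"
      by (simp add: q_def poly_prod)
    finally have "row Q k \<bullet> col V l = (\<Prod>m\<in>{..<n}-{k}. x l - x m)" .
    then show "(Q * V) $$ (k, l) = ?D $$ (k, l)"
      using kl carr by (auto intro!: prod_zero)
  qed (use carr in auto)
  have "Determinant.det (Q * V) = prod_list (diag_mat (Q * V))"
    by (rule det_upper_triangular[of _ n]) (auto simp: QV upper_triangular_def)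
  also have "\<dots> = (\<Prod>k<n. \<Prod>l\<in>{..<n}-{k}. x k - x l)"
    unfolding prod_list_diag_prod by (simp add: QV atLeast0LessThan)
  finally show ?thesis
    using carr detQ by (simp add: det_mult mult.commute)
qed

section \<open>Lorentzian forms and their isometries\<close>

text \<open>
  Forms of signature \<open>(1, n - 1)\<close>, described without a basis: some vector of positive norm has a
  negative definite orthogonal complement.
\<close>

locale lorentzian_form =
  fixes B :: "'v::real_vector \<Rightarrow> 'v \<Rightarrow> real" and e :: 'v
  assumes bilinear: "bilinear B"
    and sym: "B x y = B y x"
    and timelike: "B e e > 0"
    and negative: "x \<noteq> 0 \<Longrightarrow> B e x = 0 \<Longrightarrow> B x x < 0"
begin

lemmas form_simps = bilinear_ladd[OF bilinear] bilinear_radd[OF bilinear]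
  bilinear_lsub[OF bilinear] bilinear_rsub[OF bilinear]
  bilinear_lmul[OF bilinear] bilinear_rmul[OF bilinear]
  bilinear_lzero[OF bilinear] bilinear_rzero[OF bilinear]

lemma form_sum_left: "B (\<Sum>i\<in>A. g i) y = (\<Sum>i\<in>A. B (g i) y)"
  by (induction A rule: infinite_finite_induct) (auto simp: form_simps)

lemma nondegenerate:
  assumes "\<And>y. B x y = 0" shows "x = 0"
  using negative[of x] assms[of x] assms[of e] sym[of e x] by auto

text \<open>
  The span of \<open>x\<close> and \<open>y\<close> is totally isotropic, but if it were a plane it would contain a
  nonzero vector orthogonal to \<open>e\<close>, which has negative norm.
\<close>

lemma isotropic_orthogonal_dependent:
  assumes "B x x = 0" "B y y = 0" "B x y = 0" "x \<noteq> 0"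
  obtains a where "y = a *\<^sub>R x"
proof -
  define z where "z = B e x *\<^sub>R y - B e y *\<^sub>R x"
  have "B e z = 0" "B z z = 0"
    using assms sym[of y x] by (auto simp: z_def form_simps)
  then have "z = 0"
    using negative[of z] by auto
  moreover have "B e x \<noteq> 0"
    using negative[of x] assms by auto
  ultimately have "B e x *\<^sub>R y = B e y *\<^sub>R x" and "B e x \<noteq> 0"
    by (auto simp: z_def)
  then have "y = (B e y / B e x) *\<^sub>R x"
    by (metis (no_types) divide_inverse mult.commute scaleR_scaleR left_inverse scaleR_one)
  then show thesis by (rule that)
qed

text \<open>
  A combination of \<open>v\<close> and \<open>x\<close> is orthogonal to \<open>e\<close> and has norm at most \<open>0\<close>. By Pythagoras \<open>x\<close> has to
  compensate for the positive contribution of \<open>v\<close>.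
\<close>

lemma nonpositive_orthogonal_to_timelike:
  assumes "B v v > 0" "B x v = 0"
  shows "B x x \<le> 0"
proof -
  define z where "z = B e x *\<^sub>R v - B e v *\<^sub>R x"
  have "B e z = 0"
    by (simp add: z_def form_simps)
  then have "B z z \<le> 0"
    using negative[of z] by (cases "z = 0") (auto simp: form_simps)
  moreover have "B z z = (B e x)\<^sup>2 * B v v + (B e v)\<^sup>2 * B x x"
    using assms sym[of v x] by (simp add: z_def form_simps power2_eq_square algebra_simps)
  moreover have "B e v \<noteq> 0"
    using negative[of v] assms by (cases "v = 0") (auto simp: form_simps)
  moreover have "(B e x)\<^sup>2 * B v v \<ge> 0"
    using assms by simp
  ultimately have "(B e v)\<^sup>2 * B x x \<le> 0"
    by linarith
  then show ?thesis
    using \<open>B e v \<noteq> 0\<close> by (simp add: mult_le_0_iff not_less)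
qed

end

text \<open>
  The value \<open>B (p(f) u) w\<close> of the complex bilinear extension of the form. It is written out as a sum
  over the coefficients of \<open>p\<close>, which avoids the complexification of the space.
\<close>

definition pairing :: "('v \<Rightarrow> 'v \<Rightarrow> real) \<Rightarrow> ('v \<Rightarrow> 'v) \<Rightarrow> complex poly \<Rightarrow> 'v \<Rightarrow> 'v \<Rightarrow> complex" where
  "pairing B f p u w = (\<Sum>k\<le>degree p. coeff p k * of_real (B ((f ^^ k) u) w))"

lemma pairing_0 [simp]: "pairing B f 0 u w = 0"
  by (simp add: pairing_def)

lemma pairing_pCons [simp]:
  "pairing B f (pCons a p) u w = a * of_real (B u w) + pairing B f p (f u) w"
proof (cases "p = 0")
  case False
  then show ?thesis
    by (simp add: pairing_def sum.atMost_Suc_shift funpow_swap1 del: sum.atMost_Suc funpow.simps)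
       (simp add: funpow_swap1)
qed (simp add: pairing_def)

lemma pairing_add: "pairing B f (p + q) u w = pairing B f p u w + pairing B f q u w"
  by (induction p q arbitrary: u rule: poly_induct2) (auto simp: algebra_simps)

lemma pairing_smult: "pairing B f (Polynomial.smult c p) u w = c * pairing B f p u w"
  by (induction p arbitrary: u) (auto simp: algebra_simps)

lemma pairing_sum: "pairing B f (\<Sum>i\<in>A. g i) u w = (\<Sum>i\<in>A. pairing B f (g i) u w)"
  by (induction A rule: infinite_finite_induct) (auto simp: pairing_add)

lemma pairing_multiple_eq_0:
  assumes "\<And>u. pairing B f p u w = 0"
  shows "pairing B f (p * q) u w = 0"
  by (induction q arbitrary: u) (auto simp: assms pairing_add pairing_smult)

lemma pairing_monom: "pairing B f (monom 1 i) u w = of_real (B ((f ^^ i) u) w)"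
  by (induction i arbitrary: u) (auto simp: monom_Suc funpow_swap1 monom_0 one_pCons)

definition lagrange :: "complex set \<Rightarrow> complex \<Rightarrow> complex poly" where
  "lagrange R a = Polynomial.smult (1 / (\<Prod>b\<in>R-{a}. a - b)) (\<Prod>b\<in>R-{a}. [:- b, 1:])"

lemma poly_lagrange_eq:
  assumes "finite R" "a \<in> R" shows "poly (lagrange R a) a = 1"
  using assms by (simp add: lagrange_def poly_prod)

lemma poly_lagrange_neq:
  assumes "finite R" "b \<in> R" "b \<noteq> a" shows "poly (lagrange R a) b = 0"
  using assms by (auto simp: lagrange_def poly_prod intro!: prod_zero)

text \<open>
  Both sides have degree below the number of nodes and take the value \<open>1\<close> at each node.
\<close>

lemma sum_lagrange:
  assumes "finite R" "R \<noteq> {}"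
  shows "(\<Sum>a\<in>R. lagrange R a) = 1"
proof (rule ccontr)
  let ?p = "(\<Sum>a\<in>R. lagrange R a) - 1"
  assume neq: "(\<Sum>a\<in>R. lagrange R a) \<noteq> 1"
  have "poly ?p b = 0" if "b \<in> R" for b
  proof -
    have "(\<Sum>a\<in>R. poly (lagrange R a) b) = (\<Sum>a\<in>R. if a = b then 1 else 0)"
      using assms(1) that by (intro sum.cong) (auto simp: poly_lagrange_eq poly_lagrange_neq)
    then show ?thesis
      using assms(1) that by (simp add: poly_sum)
  qed
  then have "card R \<le> card {x. poly ?p x = 0}"
    using neq by (intro card_mono poly_roots_finite) auto
  also have "\<dots> \<le> degree ?p"
    using neq by (intro card_poly_roots_bound) auto
  also have "\<dots> \<le> card R - 1"
  proof (intro degree_diff_le degree_sum_le)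
    show "degree (lagrange R a) \<le> card R - 1" if "a \<in> R" for a
      using that assms(1) monic_prod_linear(1)[of "R - {a}" "\<lambda>x. x"]
      by (auto simp: lagrange_def intro: order.trans[OF degree_smult_le])
  qed (use assms in auto)
  finally have "card R = 0" by linarith
  then show False
    using assms by simp
qed

text \<open>
  The last assumption says, by nondegeneracy, that \<open>f\<close> is annihilated by the squarefree polynomial with
  the roots \<open>R\<close>. Consequently the vector \<open>L\<^sub>a(f) u\<close>, for \<open>L\<^sub>a\<close> the Lagrange polynomial of \<open>a \<in> R\<close>, is
  the component of \<open>u\<close> in the eigenspace of \<open>a\<close> over the complex numbers.
\<close>

locale lorentzian_isometry = lorentzian_form B e
  for B :: "'v::real_vector \<Rightarrow> 'v \<Rightarrow> real" and e :: 'v +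
  fixes f :: "'v \<Rightarrow> 'v" and R :: "complex set"
  assumes lin: "linear f"
    and isometry: "B (f x) (f y) = B x y"
    and finite_R: "finite R" and nonempty_R: "R \<noteq> {}" and nonzero_R: "0 \<notin> R"
    and annihilated: "pairing B f (\<Prod>a\<in>R. [:- a, 1:]) u w = 0"
begin

abbreviation "L \<equiv> lagrange R"

lemma pairing_isometry: "pairing B f p (f u) (f w) = pairing B f p u w"
  by (induction p arbitrary: u) (auto simp: isometry)

text \<open>
  \<open>q - q(a)\<close> is divisible by \<open>X - a\<close>, so \<open>(q - q(a)) L\<^sub>a\<close> is a multiple of the polynomial that
  annihilates \<open>f\<close>.
\<close>

lemma pairing_lagrange_mult:
  assumes "a \<in> R"
  shows "pairing B f (q * L a) u w = poly q a * pairing B f (L a) u w"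
proof -
  let ?P = "\<Prod>b\<in>R. [:- b, 1:]"
  obtain t where t: "q - [:poly q a:] = [:- a, 1:] * t"
    using poly_eq_0_iff_dvd[of "q - [:poly q a:]" a] by (auto elim: dvdE)
  have P: "[:- a, 1:] * (\<Prod>b\<in>R-{a}. [:- b, 1:]) = ?P"
    using finite_R assms by (subst prod.remove[of R a]) auto
  define c where "c = 1 / (\<Prod>b\<in>R-{a}. a - b)"
  have "q * L a = [:poly q a:] * L a + (q - [:poly q a:]) * L a"
    by (simp add: algebra_simps)
  also have "(q - [:poly q a:]) * L a = Polynomial.smult c (([:- a, 1:] * (\<Prod>b\<in>R-{a}. [:- b, 1:])) * t)"
    unfolding t lagrange_def c_def by (simp only: mult_smult_left mult_smult_right mult_ac)
  finally have "q * L a = [:poly q a:] * L a + Polynomial.smult c (?P * t)"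
    unfolding P .
  then show ?thesis
    by (simp add: pairing_add pairing_smult pairing_multiple_eq_0 annihilated)
qed

lemma pairing_expand: "pairing B f q u w = (\<Sum>a\<in>R. poly q a * pairing B f (L a) u w)"
proof -
  have "pairing B f q u w = pairing B f (\<Sum>a\<in>R. q * L a) u w"
    by (simp add: sum_lagrange finite_R nonempty_R flip: sum_distrib_left)
  then show ?thesis
    by (simp add: pairing_sum pairing_lagrange_mult)
qed

lemma pairing_lagrange_f:
  assumes "a \<in> R"
  shows "pairing B f (L a) (f u) w = a * pairing B f (L a) u w"
  using pairing_lagrange_mult[OF assms, of "[:0, 1:]" u w] by simp

lemma pairing_lagrange_funpow:
  assumes "a \<in> R"
  shows "a ^ j * pairing B f (L a) u ((f ^^ j) w) = pairing B f (L a) u w"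
proof (induction j)
  case (Suc j)
  have "a * pairing B f (L a) u (f ((f ^^ j) w)) = pairing B f (L a) u ((f ^^ j) w)"
    by (simp add: pairing_isometry flip: pairing_lagrange_f[OF assms])
  then show ?case
    using Suc by (simp add: mult.assoc mult.left_commute[of a])
qed simp

text \<open>
  This is \<open>B (f\<^bsup>i\<^esup> r) (f\<^bsup>j\<^esup> r) = \<Sum>\<^sub>a c\<^sub>a a\<^bsup>i-j\<^esup>\<close>, where \<open>c\<^sub>a\<close> is the pairing of
  the component of \<open>r\<close> for \<open>a\<close> with \<open>r\<close>. It factorises the Gram matrix of an orbit.
\<close>

lemma form_funpow_expand:
  "of_real (B ((f ^^ i) r) ((f ^^ j) r)) = (\<Sum>a\<in>R. a ^ i * (pairing B f (L a) r r / a ^ j))"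
proof -
  have "pairing B f (L a) r ((f ^^ j) r) = pairing B f (L a) r r / a ^ j" if "a \<in> R" for a
    using pairing_lagrange_funpow[OF that, of j r r] that nonzero_R
    by (metis nonzero_mult_div_cancel_left power_not_zero)
  then show ?thesis
    using pairing_expand[of "monom 1 i" r "(f ^^ j) r"]
    by (simp add: pairing_monom poly_monom cong: sum.cong)
qed

text \<open>
  The vectors \<open>x\<close> and \<open>y\<close> are the real and the imaginary part of \<open>p(f) u\<close>.
\<close>

lemma pairing_as_vectors:
  "\<exists>x y. (\<forall>w. pairing B f p u w = Complex (B x w) (B y w)) \<and>
    (\<forall>w. pairing B f p (f u) w = Complex (B (f x) w) (B (f y) w)) \<and>
    (\<forall>w. B x w = (\<Sum>k\<le>degree p. Re (coeff p k) * B ((f ^^ k) u) w)) \<and>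
    (\<forall>w. B y w = (\<Sum>k\<le>degree p. Im (coeff p k) * B ((f ^^ k) u) w))"
proof (intro exI conjI allI)
  let ?x = "\<Sum>k\<le>degree p. Re (coeff p k) *\<^sub>R (f ^^ k) u"
  let ?y = "\<Sum>k\<le>degree p. Im (coeff p k) *\<^sub>R (f ^^ k) u"
  show x: "B ?x w = (\<Sum>k\<le>degree p. Re (coeff p k) * B ((f ^^ k) u) w)" for w
    by (simp add: form_sum_left form_simps)
  show y: "B ?y w = (\<Sum>k\<le>degree p. Im (coeff p k) * B ((f ^^ k) u) w)" for w
    by (simp add: form_sum_left form_simps)
  show "pairing B f p u w = Complex (B ?x w) (B ?y w)" for w
    unfolding x y by (simp add: pairing_def complex_eq_iff)
  show "pairing B f p (f u) w = Complex (B (f ?x) w) (B (f ?y) w)" for w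
    by (simp add: pairing_def complex_eq_iff linear_sum[OF lin] linear_scale[OF lin]
        form_sum_left form_simps funpow_swap1)
qed

lemma pairing_eigenvector:
  assumes "f v = (1 / l) *\<^sub>R v" "l \<noteq> 0"
  shows "pairing B f p u v = poly p (of_real l) * of_real (B u v)"
proof (induction p arbitrary: u)
  case (pCons a p)
  have "B (f u) v = l * B (f u) (f v)"
    using assms by (simp add: form_simps)
  then have "B (f u) v = l * B u v"
    by (simp add: isometry)
  with pCons.IH show ?case
    by (simp add: algebra_simps)
qed simp

text \<open>
  Write \<open>L\<^sub>a(f) r = x + i y\<close>. Since \<open>1 / a\<close> is the conjugate of \<open>a\<close>, the coefficient is the Hermitian norm
  \<open>B x x + B y y\<close> of this eigenvector. Both \<open>x\<close> and \<open>y\<close> are orthogonal to a vector of positive norm.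
\<close>

lemma unit_coefficient:
  assumes a: "a \<in> R" "norm a = 1"
    and v: "B v v > 0" "\<And>x y. (\<And>w. pairing B f (L a) r w = Complex (B x w) (B y w)) \<Longrightarrow> B x v = 0 \<and> B y v = 0"
  shows "pairing B f (L a) r r \<in> \<real>" "Re (pairing B f (L a) r r) \<le> 0"
proof -
  let ?p = "L a" and ?c = "pairing B f (L a) r r"
  obtain x y where pair: "\<And>w. pairing B f ?p r w = Complex (B x w) (B y w)"
    and x: "\<And>w. B x w = (\<Sum>k\<le>degree ?p. Re (coeff ?p k) * B ((f ^^ k) r) w)"
    and y: "\<And>w. B y w = (\<Sum>k\<le>degree ?p. Im (coeff ?p k) * B ((f ^^ k) r) w)"
    using pairing_as_vectors[of "L a" r] by blast
  have cnj: "pairing B f ?p r ((f ^^ k) r) = ?c * cnj a ^ k" for k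
  proof -
    have "cnj a ^ k * a ^ k = 1"
      using a(2) complex_mult_cnj[of a] complex_norm_square[of a]
      by (simp add: mult.commute flip: power_mult_distrib)
    then show ?thesis
      using pairing_lagrange_funpow[OF a(1), of k r r] 
      by (metis mult.assoc mult.commute mult_1_right)
  qed
  have Re: "B ((f ^^ k) r) x = Re (?c * cnj a ^ k)" for k
    using pair[of "(f ^^ k) r"] cnj[of k] sym[of x] by (metis complex.sel(1))
  have Im: "B ((f ^^ k) r) y = Im (?c * cnj a ^ k)" for k
    using pair[of "(f ^^ k) r"] cnj[of k] sym[of y] by (metis complex.sel(2))
  have "?c = ?c * cnj (poly ?p a)"
    using poly_lagrange_eq[OF finite_R a(1)] by simp
  also have "\<dots> = (\<Sum>k\<le>degree ?p. cnj (coeff ?p k) * (?c * cnj a ^ k))"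
    by (simp add: poly_altdef sum_distrib_left mult_ac)
  finally have c: "?c = (\<Sum>k\<le>degree ?p. cnj (coeff ?p k) * (?c * cnj a ^ k))" .
  have "Re ?c = B x x + B y y"
    by (subst c) (simp add: x[of x] y[of y] Re Im sum.distrib)
  moreover have "Im ?c = B x y - B y x"
    by (subst c) (simp add: x[of y] y[of x] Re Im sum_subtractf)
  moreover have "B x x \<le> 0" "B y y \<le> 0"
    using v(2)[OF pair] by (auto intro!: nonpositive_orthogonal_to_timelike[OF v(1)])
  ultimately show "?c \<in> \<real>" "Re ?c \<le> 0"
    using sym[of x y] by (auto simp: complex_is_Real_iff)
qed

end

section \<open>Spectral coefficients and the Gram matrix of an orbit\<close>

context lorentzian_isometry begin

lemma eigenvector_isotropic:
  assumes "f v = l *\<^sub>R v" "l\<^sup>2 \<noteq> 1" shows "B v v = 0"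
proof -
  have "B v v = l\<^sup>2 * B v v"
    using isometry[of v v] assms(1) by (simp add: form_simps power2_eq_square)
  then show ?thesis using assms(2) by simp
qed

text \<open>
  Both vectors are isotropic. If they were orthogonal they would be proportional, but their eigenvalues
  differ.
\<close>

lemma inverse_eigenvectors_not_orthogonal:
  assumes "f v = l *\<^sub>R v" "f w = (1 / l) *\<^sub>R w" "l \<noteq> 0" "l\<^sup>2 \<noteq> 1" "v \<noteq> 0" "w \<noteq> 0"
  shows "B v w \<noteq> 0"
proof
  assume "B v w = 0"
  moreover have "B v v = 0" "B w w = 0"
    using eigenvector_isotropic[of v l] eigenvector_isotropic[of w "1 / l"] assms
    by (auto simp: power_divide)
  ultimately obtain a where a: "w = a *\<^sub>R v"
    using isotropic_orthogonal_dependent[of v w] assms(5) by blast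
  then have "(a * l) *\<^sub>R v = (a / l) *\<^sub>R v"
    using assms(1,2) by (simp add: linear_scale[OF lin])
  then have "a * l\<^sup>2 = a"
    using assms(3,5) by (simp add: field_simps power2_eq_square)
  then show False
    using a assms by auto
qed

text \<open>
  The component of \<open>r\<close> for the eigenvalue \<open>l\<close> is a multiple of \<open>v\<close>, because the eigenspace of \<open>l\<close> is
  totally isotropic and therefore a line. Pairing with \<open>w\<close> determines the multiple.
\<close>

lemma axis_coefficient:
  assumes l: "of_real l \<in> R" "l \<noteq> 0" "l\<^sup>2 \<noteq> 1"
    and v: "f v = l *\<^sub>R v" and w: "f w = (1 / l) *\<^sub>R w" and vw: "B v w \<noteq> 0"
  shows "pairing B f (L (of_real l)) r r = of_real (B r v * B r w / B v w)"
proof -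
  let ?p = "L (of_real l)"
  obtain x y where pair: "\<And>u. pairing B f ?p r u = Complex (B x u) (B y u)"
    and pair_f: "\<And>u. pairing B f ?p (f r) u = Complex (B (f x) u) (B (f y) u)"
    using pairing_as_vectors[of ?p r] by blast
  have "Complex (B (f x) u) (B (f y) u) = Complex (B (l *\<^sub>R x) u) (B (l *\<^sub>R y) u)" for u
    using pairing_lagrange_f[OF l(1), of r u] unfolding pair pair_f
    by (simp add: complex_eq_iff form_simps)
  then have "B (f x - l *\<^sub>R x) u = 0" "B (f y - l *\<^sub>R y) u = 0" for u
    by (simp_all add: form_simps)
  then have "f x - l *\<^sub>R x = 0" "f y - l *\<^sub>R y = 0"
    by (blast intro: nondegenerate)+
  then have fxy: "f x = l *\<^sub>R x" "f y = l *\<^sub>R y"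
    by simp_all
  have "v \<noteq> 0"
    using vw by (auto simp: form_simps)
  have multiple: "\<exists>a. z = a *\<^sub>R v" if z: "f z = l *\<^sub>R z" for z
  proof -
    have "B v z = l\<^sup>2 * B v z"
      using isometry[of v z] v z by (simp add: form_simps power2_eq_square)
    then have "B v z = 0"
      using l(3) by simp
    then show ?thesis
      using isotropic_orthogonal_dependent[of v z] eigenvector_isotropic[OF v l(3)]
        eigenvector_isotropic[OF z l(3)] \<open>v \<noteq> 0\<close> by blast
  qed
  obtain a b where a: "x = a *\<^sub>R v" and b: "y = b *\<^sub>R v"
    using multiple fxy by blast
  have "Complex (B x w) (B y w) = of_real (B r w)"
    using pairing_eigenvector[OF w l(2), of ?p r] poly_lagrange_eq[OF finite_R l(1)]
    by (simp flip: pair)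
  then have "B x w = B r w" "B y w = 0"
    by (simp_all add: complex_eq_iff)
  then have "a = B r w / B v w" "b = 0"
    using vw by (simp_all add: a b form_simps field_simps)
  then show ?thesis
    using sym[of v r] by (simp add: pair a b form_simps complex_eq_iff)
qed

text \<open>
  All coefficients are real and at most \<open>0\<close>: those on the unit circle by \<open>unit_coefficient\<close> with the
  vector \<open>v + w\<close> of positive norm, the other two because of the assumption on \<open>r\<close>. Their absolute values
  therefore have sum \<open>2\<close>, and the bound on the product follows from \<open>x \<le> exp (x - 1)\<close>.
\<close>

lemma prod_coefficients_le_1:
  assumes l: "of_real l \<in> R" "of_real (1 / l) \<in> R" "l > 1"
    and unit: "\<And>a. a \<in> R \<Longrightarrow> a \<noteq> of_real l \<Longrightarrow> a \<noteq> of_real (1 / l) \<Longrightarrow> norm a = 1"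
    and v: "f v = l *\<^sub>R v" and w: "f w = (1 / l) *\<^sub>R w" and vw: "B v w > 0"
    and r: "B r r = -2" "B r v * B r w \<le> 0"
  shows "(\<Prod>a\<in>R. norm (pairing B f (L a) r r)) \<le> 1"
proof -
  let ?c = "\<lambda>a. pairing B f (L a) r r"
  have l2: "l\<^sup>2 \<noteq> 1" "(1 / l)\<^sup>2 \<noteq> 1" "l \<noteq> 0"
    using l(3) by (auto simp: power2_eq_1_iff power_divide)
  have axis: "B r v * B r w / B v w \<le> 0"
    using r(2) vw by (simp add: divide_nonpos_pos)
  have "?c a \<in> \<real> \<and> Re (?c a) \<le> 0" if a: "a \<in> R" for a
  proof -
    consider "a = of_real l" | "a = of_real (1 / l)" | "a \<noteq> of_real l" "a \<noteq> of_real (1 / l)"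
      by blast
    then show ?thesis
    proof cases
      case 1
      then show ?thesis
        using axis_coefficient[OF l(1) l2(3,1) v w] vw axis by simp
    next
      case 2
      have "f v = (1 / (1 / l)) *\<^sub>R v"
        using v by simp
      then have "?c a = of_real (B r w * B r v / B w v)"
        using axis_coefficient[OF l(2) _ l2(2) w] vw l2 sym[of v w] unfolding 2 by simp
      then show ?thesis
        using axis sym[of v w] by (simp add: mult.commute)
    next
      case 3
      have "B v v = 0" "B w w = 0"
        using eigenvector_isotropic v w l2 by blast+
      then have time: "B (v + w) (v + w) > 0"
        using vw sym[of v w] by (simp add: form_simps)
      have "pairing B f (L a) r w = 0"
        using pairing_eigenvector[OF w l2(3), of "L a" r] poly_lagrange_neq[OF finite_R l(1)] 3 by simp
      moreover have "pairing B f (L a) r v = 0"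
        using pairing_eigenvector[of v "1 / l" "L a" r] poly_lagrange_neq[OF finite_R l(2)] 3 v l2 by simp
      ultimately have "B x (v + w) = 0 \<and> B y (v + w) = 0"
        if "\<And>u. pairing B f (L a) r u = Complex (B x u) (B y u)" for x y
        using that[of v] that[of w] by (simp add: complex_eq_iff form_simps)
      then show ?thesis
        using unit_coefficient[OF a unit[OF a 3] time] by blast
    qed
  qed
  then have "Im (?c a) = 0 \<and> Re (?c a) \<le> 0" if "a \<in> R" for a
    using that by (simp add: complex_is_Real_iff)
  then have norm_c: "complex_of_real (norm (?c a)) = - ?c a" if "a \<in> R" for a
    using that by (simp add: complex_eq_iff cmod_eq_Re)
  have "complex_of_real (\<Sum>a\<in>R. norm (?c a)) = - (\<Sum>a\<in>R. ?c a)"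
    by (simp add: norm_c sum_negf)
  also have "(\<Sum>a\<in>R. ?c a) = pairing B f 1 r r"
    by (subst pairing_expand[of 1]) simp
  also have "\<dots> = - 2"
    using r(1) by (simp add: one_pCons)
  finally have sum: "(\<Sum>a\<in>R. norm (?c a)) = 2"
    by (simp add: complex_eq_iff)
  have "l \<noteq> 1 / l"
    using l2 by (auto simp: field_simps power2_eq_square)
  then have "complex_of_real l \<noteq> of_real (1 / l)"
    using of_real_eq_iff by blast
  then have "card {complex_of_real l, of_real (1 / l)} = 2"
    by (simp only: card_2_iff) blast
  then have card: "2 \<le> card R"
    using card_mono[OF finite_R, of "{of_real l, of_real (1 / l)}"] l by simp
  have "(\<Prod>a\<in>R. norm (?c a)) \<le> (\<Prod>a\<in>R. exp (norm (?c a) - 1))"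
    using exp_ge_add_one_self[of "_ - 1"] by (intro prod_mono) (auto simp: add.commute)
  also have "\<dots> = exp (2 - real (card R))"
    by (simp add: sum sum_subtractf flip: exp_sum[OF finite_R])
  also have "\<dots> \<le> 1"
    using card by simp
  finally show ?thesis .
qed

text \<open>
  By \<open>form_funpow_expand\<close> the Gram matrix is \<open>V D W\<close>, with the two Vandermonde matrices of
  \<open>det_vandermonde_product\<close> and a diagonal matrix \<open>D\<close> with the entries \<open>c\<^sub>a / a\<^bsup>n-1\<^esup>\<close>.
\<close>

lemma norm_det_orbit_gram:
  assumes unit: "(\<Prod>a\<in>R. norm a) = 1"
  defines "n \<equiv> card R"
  shows "\<bar>Determinant.det (mat n n (\<lambda>(i, j). B ((f ^^ i) r) ((f ^^ j) r)))\<bar>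
    = (\<Prod>a\<in>R. norm (pairing B f (L a) r r)) * (\<Prod>a\<in>R. \<Prod>b\<in>R-{a}. norm (a - b))"
proof -
  let ?c = "\<lambda>a. pairing B f (L a) r r"
  obtain x where x: "bij_betw x {..<n} R"
    using ex_bij_betw_nat_finite[OF finite_R] by (auto simp: n_def atLeast0LessThan)
  have x0: "x k \<noteq> 0" if "k < n" for k
    using bij_betwE[OF x] nonzero_R that by (metis lessThan_iff)
  define M where "M = mat n n (\<lambda>(i, j). B ((f ^^ i) r) ((f ^^ j) r))"
  define V where "V = mat n n (\<lambda>(i, k). x k ^ i)"
  define W where "W = mat n n (\<lambda>(k, j). x k ^ (n - 1 - j))"
  define D where "D = mat n n (\<lambda>(k, j). if k = j then ?c (x k) / x k ^ (n - 1) else 0)"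
  have carr: "M \<in> carrier_mat n n" "V \<in> carrier_mat n n" "D \<in> carrier_mat n n" "W \<in> carrier_mat n n"
    by (auto simp: M_def V_def D_def W_def)
  have "map_mat complex_of_real M = V * (D * W)"
  proof (rule eq_matI)
    fix i j assume "i < dim_row (V * (D * W))" "j < dim_col (V * (D * W))"
    then have ij: "i < n" "j < n" using carr by auto
    have DW: "(D * W) $$ (k, j) = ?c (x k) / x k ^ j" if "k < n" for k
    proof -
      have "(D * W) $$ (k, j) = (\<Sum>m<n. D $$ (k, m) * W $$ (m, j))"
        using that ij carr by (intro index_mult_mat_sum)
      also have "\<dots> = (\<Sum>m<n. if m = k then ?c (x k) / x k ^ (n - 1) * x k ^ (n - 1 - j) else 0)"
        using that ij by (intro sum.cong) (auto simp: D_def W_def)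
      also have "\<dots> = ?c (x k) / x k ^ (n - 1) * x k ^ (n - 1 - j)"
        using that by simp
      also have "\<dots> = ?c (x k) / x k ^ j"
        using x0[OF that] ij by (simp add: power_diff)
      finally show ?thesis .
    qed
    have "(V * (D * W)) $$ (i, j) = (\<Sum>k<n. V $$ (i, k) * (D * W) $$ (k, j))"
      using ij carr by (intro index_mult_mat_sum[of _ n n]) auto
    also have "\<dots> = (\<Sum>k<n. x k ^ i * (?c (x k) / x k ^ j))"
      using ij by (intro sum.cong refl) (simp add: DW V_def del: index_mult_mat(1))
    also have "\<dots> = of_real (B ((f ^^ i) r) ((f ^^ j) r))"
      unfolding form_funpow_expand by (rule sum.reindex_bij_betw[OF x])
    finally show "map_mat complex_of_real M $$ (i, j) = (V * (D * W)) $$ (i, j)"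
      using ij by (simp add: M_def)
  qed (use carr in auto)
  then have "complex_of_real (Determinant.det M) = Determinant.det (V * (D * W))"
    by (metis of_real_hom.hom_det)
  also have "\<dots> = Determinant.det D * (Determinant.det V * Determinant.det W)"
    using carr by (simp add: det_mult[of _ n])
  also have "Determinant.det V * Determinant.det W = (\<Prod>k<n. \<Prod>l\<in>{..<n}-{k}. x k - x l)"
    unfolding V_def W_def by (rule det_vandermonde_product)
  also have "\<dots> = (\<Prod>k<n. \<Prod>b\<in>R-{x k}. x k - b)"
  proof (intro prod.cong refl)
    fix k assume "k \<in> {..<n}"
    then have "bij_betw x ({..<n} - {k}) (R - {x k})"
      using x by (intro bij_betw_DiffI) (auto simp: bij_betw_def)
    then show "(\<Prod>l\<in>{..<n}-{k}. x k - x l) = (\<Prod>b\<in>R-{x k}. x k - b)"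
      by (rule prod.reindex_bij_betw)
  qed
  also have "\<dots> = (\<Prod>a\<in>R. \<Prod>b\<in>R-{a}. a - b)"
    by (rule prod.reindex_bij_betw[OF x])
  also have "Determinant.det D = prod_list (diag_mat D)"
    by (rule det_upper_triangular[of _ n]) (auto simp: D_def upper_triangular_def)
  also have "\<dots> = (\<Prod>k<n. ?c (x k) / x k ^ (n - 1))"
    unfolding prod_list_diag_prod by (simp add: D_def atLeast0LessThan)
  also have "\<dots> = (\<Prod>a\<in>R. ?c a / a ^ (n - 1))"
    by (rule prod.reindex_bij_betw[OF x])
  finally have "norm (complex_of_real (Determinant.det M))
      = norm ((\<Prod>a\<in>R. ?c a / a ^ (n - 1)) * (\<Prod>a\<in>R. \<Prod>b\<in>R-{a}. a - b))"
    by simp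
  moreover have "(\<Prod>a\<in>R. norm a ^ (n - 1)) = 1"
    using unit by (simp add: prod_power_distrib[symmetric])
  ultimately show ?thesis
    by (simp add: M_def norm_mult norm_divide norm_power prod_norm[symmetric] prod_dividef)
qed

end

section \<open>Hyperbolic lattices are Lorentzian\<close>

lemma poly_eq_prod_proots:
  fixes p :: "'a::idom poly"
  assumes "size (proots p) = degree p"
  shows "p = Polynomial.smult (lead_coeff p) (\<Prod>x\<in>#proots p. [:- x, 1:])"
  using assms
proof (induction p rule: poly_root_order_induct)
  case (no_roots p)
  then have "proots p = {#}"
    by (simp add: multiset_eqI order_root)
  with no_roots have "degree p = 0" by simp
  with \<open>proots p = {#}\<close> show ?case
    by (auto elim!: degree_eq_zeroE)
next
  case (root p x n)
  have "p \<noteq> 0"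
    using root.hyps by auto
  then have eq: "proots ([:- x, 1:] ^ n * p) = repeat_mset n {#x#} + proots p"
    by (simp add: proots_mult proots_power)
  have "size (proots p) = degree p"
    using root.prems \<open>p \<noteq> 0\<close> unfolding eq by (simp add: degree_mult_eq degree_power_eq)
  then have "p = Polynomial.smult (lead_coeff p) (\<Prod>x\<in>#proots p. [:- x, 1:])"
    by (rule root.IH)
  then show ?case
    unfolding eq by (simp add: lead_coeff_mult lead_coeff_power)
       (metis mult_smult_right)
qed auto

text \<open>
  The spectral theorem for the operator that represents \<open>B\<close> with respect to the scalar product \<open>E\<close>,
  starting from an independent family \<open>p\<close> in which this operator is triangular: if Gram-Schmidt turns
  \<open>p\<close> into the orthogonal family \<open>u\<close>, the operator is still triangular, and by symmetry it is then diagonal.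
\<close>

lemma orthogonal_eigenvectors:
  fixes B E :: "'v::real_vector \<Rightarrow> 'v \<Rightarrow> real" and p :: "nat \<Rightarrow> 'v"
  assumes bB: "bilinear B" and bE: "bilinear E"
    and symB: "\<And>x y. B x y = B y x" and symE: "\<And>x y. E x y = E y x"
    and pos: "\<And>x. x \<noteq> 0 \<Longrightarrow> E x x > 0"
    and triangular: "\<And>k x. k < n \<Longrightarrow> B (p k) x = (\<Sum>i\<le>k. T i k * E (p i) x)"
    and indep: "\<And>k. k < n \<Longrightarrow> p k \<notin> span (p ` {..<k})"
    and "m \<le> n"
  shows "\<exists>u. (\<forall>k<m. u k \<noteq> 0 \<and> (\<forall>x. B (u k) x = T k k * E (u k) x)) \<and>
    (\<forall>i<m. \<forall>j<m. i \<noteq> j \<longrightarrow> E (u i) (u j) = 0) \<and> span (u ` {..<m}) = span (p ` {..<m})"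
  using \<open>m \<le> n\<close>
proof (induction m)
  case 0
  show ?case by simp
next
  case (Suc m)
  have add: "B (x + y) z = B x z + B y z" "B (x - y) z = B x z - B y z" "B (a *\<^sub>R x) z = a * B x z"
    "E (x + y) z = E x z + E y z" "E (x - y) z = E x z - E y z" "E (a *\<^sub>R x) z = a * E x z" for x y z a
    using bilinear_ladd[OF bB] bilinear_ladd[OF bE] bilinear_lsub[OF bB] bilinear_lsub[OF bE]
      bilinear_lmul[OF bB] bilinear_lmul[OF bE] by simp_all
  have sum: "B (\<Sum>i<m. g i) z = (\<Sum>i<m. B (g i) z)" "E (\<Sum>i<m. g i) z = (\<Sum>i<m. E (g i) z)" for g z
    using linear_sum[of "\<lambda>x. B x z"] linear_sum[of "\<lambda>x. E x z"] bB bE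
    by (auto simp: bilinear_def)
  have "\<exists>u. (\<forall>k<m. u k \<noteq> 0 \<and> (\<forall>x. B (u k) x = T k k * E (u k) x)) \<and>
      (\<forall>i<m. \<forall>j<m. i \<noteq> j \<longrightarrow> E (u i) (u j) = 0) \<and> span (u ` {..<m}) = span (p ` {..<m})"
    by (rule Suc.IH[OF Suc_leD[OF Suc.prems]])
  then obtain u where u: "(\<forall>k<m. u k \<noteq> 0 \<and> (\<forall>x. B (u k) x = T k k * E (u k) x)) \<and>
      (\<forall>i<m. \<forall>j<m. i \<noteq> j \<longrightarrow> E (u i) (u j) = 0) \<and> span (u ` {..<m}) = span (p ` {..<m})" ..
  then have u0: "u k \<noteq> 0" and uB: "B (u k) x = T k k * E (u k) x" if "k < m" for k x
    using that by simp_all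
  have uE: "E (u i) (u j) = 0" if "i < m" "j < m" "i \<noteq> j" for i j
    using u that by simp
  have span: "span (u ` {..<m}) = span (p ` {..<m})"
    using u by (elim conjE)
  define c where "c i = E (p m) (u i) / E (u i) (u i)" for i
  define q where "q = p m - (\<Sum>i<m. c i *\<^sub>R u i)"
  \<comment> \<open>The defect of \<open>q\<close> from being an eigenvector; it lies in the span of the earlier vectors but is
    orthogonal to them.\<close>
  define w where "w = (\<Sum>i<m. T i m *\<^sub>R p i) + (\<Sum>i<m. (c i * (T m m - T i i)) *\<^sub>R u i)"
  have m: "m < n" using Suc.prems by simp
  have comb: "(\<Sum>i<m. c i *\<^sub>R u i) \<in> span (u ` {..<m})"
    by (intro span_sum span_scale span_base) auto
  have q0: "q \<noteq> 0"
    using comb indep[OF m] span by (auto simp: q_def)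
  have qu: "E q (u j) = 0" if j: "j < m" for j
  proof -
    have "(\<Sum>i<m. c i * E (u i) (u j)) = (\<Sum>i<m. if i = j then c j * E (u j) (u j) else 0)"
      using j uE by (intro sum.cong) auto
    then show ?thesis
      using j pos[OF u0[OF j]] by (simp add: q_def add sum c_def)
  qed
  have Bq: "B q x = T m m * E q x + E w x" for x
  proof -
    have "B q x = (\<Sum>i<m. T i m * E (p i) x) + T m m * E (p m) x - (\<Sum>i<m. c i * (T i i * E (u i) x))"
      using uB triangular[OF m] by (simp add: q_def add sum lessThan_Suc_atMost[symmetric])
    also have "\<dots> = T m m * E q x + E w x"
      by (simp add: q_def w_def add sum algebra_simps sum_subtractf sum_distrib_left sum.distrib)
    finally show ?thesis .
  qed
  have wu: "E w (u j) = 0" if j: "j < m" for j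
  proof -
    have "B q (u j) = T j j * E q (u j)"
      using uB[OF j, of q] symB symE by metis
    then show ?thesis
      using Bq[of "u j"] qu[OF j] by simp
  qed
  have "w \<in> span (u ` {..<m})"
    unfolding w_def
  proof (intro span_add span_sum span_scale)
    show "p i \<in> span (u ` {..<m})" if "i \<in> {..<m}" for i
      unfolding span using that by (intro span_base) auto
    show "u i \<in> span (u ` {..<m})" if "i \<in> {..<m}" for i
      using that by (intro span_base) auto
  qed
  then have "E w w = 0"
    using linear_eq_0_on_span[of "E w" "u ` {..<m}" w] bE wu by (auto simp: bilinear_def)
  then have "w = 0"
    using pos by force
  then have Bq: "B q x = T m m * E q x" for x
    using Bq[of x] add(6)[of 0 0 x] by simp
  let ?u = "u(m := q)"
  have "?u ` {..<Suc m} = insert q (u ` {..<m})"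
    by (auto simp: lessThan_Suc)
  moreover have "p ` {..<Suc m} = insert (p m) (p ` {..<m})"
    by (auto simp: lessThan_Suc)
  moreover have "span (insert q (u ` {..<m})) = span (insert (p m) (u ` {..<m}))"
    using comb by (intro eq_span_insert_eq) (auto simp: q_def span_neg)
  moreover have "span (insert (p m) (u ` {..<m})) = span (insert (p m) (p ` {..<m}))"
    using span by (auto simp: span_insert)
  ultimately have "span (?u ` {..<Suc m}) = span (p ` {..<Suc m})"
    by metis
  moreover have "?u k \<noteq> 0 \<and> (\<forall>x. B (?u k) x = T k k * E (?u k) x)" if "k < Suc m" for k
    using that u0 uB q0 Bq by (auto simp: less_Suc_eq)
  moreover have "E (?u i) (?u j) = 0" if "i < Suc m" "j < Suc m" "i \<noteq> j" for i j
    using that uE qu symE by (auto simp: less_Suc_eq)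
  ultimately show ?case
    by (intro exI[of _ ?u]) simp
qed

lemma sum_representation_list:
  fixes bs :: "'v::euclidean_space list"
  assumes "distinct bs" "independent (set bs)" "span (set bs) = UNIV"
  shows "(\<Sum>i<length bs. representation (set bs) x (bs ! i) *\<^sub>R bs ! i) = x"
proof -
  have "(\<Sum>i<length bs. representation (set bs) x (bs ! i) *\<^sub>R bs ! i)
      = (\<Sum>b\<in>set bs. representation (set bs) x b *\<^sub>R b)"
    by (rule sum.reindex_bij_betw[OF bij_betw_nth[OF assms(1) refl refl]])
  then show ?thesis
    using assms by (simp add: real_vector.sum_representation_eq)
qed

lemma linear_representation:
  fixes bs :: "'v::euclidean_space list"
  assumes "independent (set bs)" "span (set bs) = UNIV"
  shows "linear (\<lambda>x. representation (set bs) x b)"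
  using assms
  by (intro linearI) (auto simp: real_vector.representation_add real_vector.representation_scale)

lemma representation_list_sum:
  fixes bs :: "'v::euclidean_space list"
  assumes "distinct bs" "independent (set bs)" "span (set bs) = UNIV" "j < length bs"
  shows "representation (set bs) (\<Sum>i<length bs. c i *\<^sub>R bs ! i) (bs ! j) = c j"
proof -
  note lin = linear_representation[OF assms(2,3), of "bs ! j"]
  have "representation (set bs) (\<Sum>i<length bs. c i *\<^sub>R bs ! i) (bs ! j)
      = (\<Sum>i<length bs. c i * representation (set bs) (bs ! i) (bs ! j))"
    using linear_sum[OF lin, of "\<lambda>i. c i *\<^sub>R bs ! i" "{..<length bs}"]
    by (simp add: linear_scale[OF lin])
  also have "\<dots> = (\<Sum>i<length bs. if i = j then c i else 0)"
    using assms by (intro sum.cong) (auto simp: real_vector.representation_basis nth_eq_iff_index_eq)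
  finally show ?thesis using assms(4) by simp
qed

text \<open>
  The signature accounts for \<open>n\<close> eigenvalues, so the characteristic polynomial splits over the reals and
  has no root \<open>0\<close>.
\<close>

lemma hyperbolic_eigenvalues:
  assumes G: "G \<in> carrier_mat n n" and sig: "signature G = (1, n - 1)"
  obtains l ns where "char_poly G = (\<Prod>a\<leftarrow>l # ns. [:- a, 1:])" "l > 0" "\<And>a. a \<in> set ns \<Longrightarrow> a < 0"
    "length (l # ns) = n"
proof -
  let ?p = "char_poly G"
  let ?P = "filter_mset (\<lambda>x. x > 0) (proots ?p)" and ?N = "filter_mset (\<lambda>x. x < 0) (proots ?p)"
  have deg: "degree ?p = n" "lead_coeff ?p = 1"
    using degree_monic_char_poly[OF G] by auto
  have size: "size ?P = 1" "size ?N = n - 1"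
    using sig by (auto simp: signature_def)
  have "size ?P \<le> size (proots ?p)"
    by (rule size_filter_mset_lesseq)
  then have n: "n \<ge> 1"
    using size_proots_le[of ?p] size deg by linarith
  have sub: "?P + ?N \<subseteq># proots ?p"
    by (rule mset_subset_eqI) auto
  moreover have "size (proots ?p) \<le> size (?P + ?N)"
    using size n deg size_proots_le[of ?p] by simp
  ultimately have eq: "proots ?p = ?P + ?N"
    by (metis mset_subset_size not_less subset_mset.le_imp_less_or_eq)
  obtain l where l: "?P = {#l#}"
    using size(1) size_1_singleton_mset by blast
  obtain ns where ns: "mset ns = ?N"
    using ex_mset by blast
  have "size (proots ?p) = degree ?p"
    using eq size n deg by (metis add.commute le_add_diff_inverse2 size_union)
  then have "?p = (\<Prod>x\<in>#proots ?p. [:- x, 1:])"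
    using poly_eq_prod_proots[of ?p] deg by simp
  also have "proots ?p = mset (l # ns)"
    using eq l ns by simp
  also have "(\<Prod>x\<in>#mset (l # ns). [:- x, 1:]) = (\<Prod>a\<leftarrow>l # ns. [:- a, 1:])"
    by (metis mset_map prod_mset_prod_list)
  finally have "?p = (\<Prod>a\<leftarrow>l # ns. [:- a, 1:])" .
  moreover have "l > 0"
  proof -
    have "l \<in># ?P" using l by simp
    then show ?thesis by simp
  qed
  moreover have "a < 0" if "a \<in> set ns" for a
  proof -
    have "a \<in># ?N" using that ns by (metis set_mset_mset)
    then show ?thesis by simp
  qed
  moreover have "length (l # ns) = n"
  proof -
    have "length ns = n - 1"
      using size(2) ns by (metis size_mset)
    then show ?thesis using n by simp
  qed
  ultimately show thesis by (rule that)
qed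

text \<open>
  The Gram matrix is diagonalised orthogonally with respect to the scalar product \<open>E\<close> that makes the lattice
  basis orthonormal. The eigenvector of the positive eigenvalue is the required vector: its \<open>B\<close>-orthogonal
  complement is spanned by the eigenvectors of the negative ones.
\<close>

lemma hyperbolic_imp_lorentzian:
  fixes B :: "'v::euclidean_space \<Rightarrow> 'v \<Rightarrow> real"
  assumes "hyperbolic_lattice L B"
  obtains e where "lorentzian_form B e"
proof -
  obtain bs where bs: "lattice_basis L bs" and sig: "signature (gram_matrix B bs) = (1, length bs - 1)"
    and bB: "bilinear B" and symB: "\<And>x y. B x y = B y x"
    using assms by (auto simp: hyperbolic_lattice_def integral_lattice_def)
  have basis: "distinct bs" "independent (set bs)" "span (set bs) = UNIV"
    using bs by (auto simp: lattice_basis_def)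
  define n where "n = length bs"
  define co where "co x i = representation (set bs) x (bs ! i)" for x i
  have lin_co: "linear (\<lambda>x. co x i)" for i
    unfolding co_def by (rule linear_representation[OF basis(2,3)])
  note co_simps = linear_add[OF lin_co] linear_scale[OF lin_co] linear_sum[OF lin_co]
  have expand: "(\<Sum>i<n. co x i *\<^sub>R bs ! i) = x" for x
    unfolding co_def n_def by (rule sum_representation_list[OF basis])
  have co_sum: "co (\<Sum>i<n. c i *\<^sub>R bs ! i) j = c j" if "j < n" for c j
    using that unfolding co_def n_def by (rule representation_list_sum[OF basis])
  define E where "E x y = (\<Sum>i<n. co x i * co y i)" for x y
  have bE: "bilinear E"
    unfolding bilinear_def
    by (auto intro!: linearI simp: E_def co_simps algebra_simps sum.distrib sum_distrib_left)
  have symE: "E x y = E y x" for x y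
    by (simp add: E_def mult.commute)
  have posE: "E x x > 0" if "x \<noteq> 0" for x
  proof -
    have "\<exists>i<n. co x i \<noteq> 0"
      using expand[of x] that by (metis (mono_tags, lifting) lessThan_iff scaleR_zero_left sum.neutral)
    then show ?thesis
      unfolding E_def by (auto intro!: sum_pos2 simp: zero_less_mult_iff linorder_neq_iff)
  qed
  define G where "G = gram_matrix B bs"
  have G: "G \<in> carrier_mat n n"
    by (simp add: G_def gram_matrix_def n_def)
  obtain l ns where cp: "char_poly G = (\<Prod>a\<leftarrow>l # ns. [:- a, 1:])" and l: "l > 0"
    and ns: "\<And>a. a \<in> set ns \<Longrightarrow> a < 0" and len: "length (l # ns) = n"
    using hyperbolic_eigenvalues[OF G] sig by (auto simp: G_def n_def)
  obtain T P Q :: "real mat" where schur: "schur_decomposition G (l # ns) = (T, P, Q)"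
    by (metis prod_cases3)
  have sim: "similar_mat_wit G T P Q" and T: "upper_triangular T" "diag_mat T = l # ns"
    using schur_decomposition[OF G cp schur] by auto
  have carr: "T \<in> carrier_mat n n" "P \<in> carrier_mat n n" "Q \<in> carrier_mat n n"
    and PQ: "P * Q = 1\<^sub>m n" and QP: "Q * P = 1\<^sub>m n" and GPTQ: "G = P * T * Q"
    using sim G unfolding similar_mat_wit_def Let_def by auto
  have GP: "G * P = P * T"
    unfolding GPTQ using carr QP by (simp add: assoc_mult_mat[of _ n n _ n _ n])
  define p where "p k = (\<Sum>i<n. P $$ (i, k) *\<^sub>R bs ! i)" for k
  have co_p: "co (p k) i = P $$ (i, k)" if "i < n" for i k
    using that by (simp add: p_def co_sum)
  have triangular: "B (p k) x = (\<Sum>i\<le>k. T $$ (i, k) * E (p i) x)" if k: "k < n" for k x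
  proof -
    have "B (p k) x = B (p k) (\<Sum>j<n. co x j *\<^sub>R bs ! j)"
      by (simp add: expand)
    also have "\<dots> = (\<Sum>i<n. \<Sum>j<n. P $$ (i, k) * (co x j * B (bs ! i) (bs ! j)))"
      unfolding p_def bilinear_sum[OF bB] sum.cartesian_product[symmetric]
      by (simp add: bilinear_lmul[OF bB] bilinear_rmul[OF bB] mult.left_commute)
    also have "\<dots> = (\<Sum>j<n. \<Sum>i<n. P $$ (i, k) * (co x j * B (bs ! i) (bs ! j)))"
      by (rule sum.swap)
    also have "\<dots> = (\<Sum>j<n. co x j * (\<Sum>i<n. G $$ (j, i) * P $$ (i, k)))"
      unfolding sum_distrib_left
    proof (intro sum.cong refl)
      fix i j assume "i \<in> {..<n}" "j \<in> {..<n}"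
      then show "P $$ (i, k) * (co x j * B (bs ! i) (bs ! j)) = co x j * (G $$ (j, i) * P $$ (i, k))"
        using symB[of "bs ! i" "bs ! j"] by (simp add: G_def gram_matrix_def n_def)
    qed
    also have "\<dots> = (\<Sum>j<n. co x j * (\<Sum>i<n. P $$ (j, i) * T $$ (i, k)))"
    proof (rule sum.cong[OF refl])
      fix j assume "j \<in> {..<n}"
      then have j: "j < n" by simp
      show "co x j * (\<Sum>i<n. G $$ (j, i) * P $$ (i, k)) = co x j * (\<Sum>i<n. P $$ (j, i) * T $$ (i, k))"
        using index_mult_mat_sum[OF G carr(2) j k] index_mult_mat_sum[OF carr(2,1) j k] GP by simp
    qed
    also have "\<dots> = (\<Sum>i<n. T $$ (i, k) * E (p i) x)"
      unfolding E_def sum_distrib_left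
      by (subst sum.swap) (intro sum.cong refl, simp add: co_p)
    also have "\<dots> = (\<Sum>i\<le>k. T $$ (i, k) * E (p i) x)"
      using T(1) carr k by (intro sum.mono_neutral_right) (auto simp: upper_triangular_def)
    finally show ?thesis .
  qed
  have indep: "p k \<notin> span (p ` {..<k})" if k: "k < n" for k
  proof
    assume mem: "p k \<in> span (p ` {..<k})"
    \<comment> \<open>The coordinate function dual to \<open>p k\<close>.\<close>
    define h where "h x = (\<Sum>i<n. Q $$ (k, i) * co x i)" for x
    have lin: "linear h"
      by (intro linearI) (simp_all add: h_def co_simps algebra_simps sum.distrib sum_distrib_left)
    have h: "h (p j) = (if j = k then 1 else 0)" if "j < n" for j
      using index_mult_mat_sum[OF carr(3,2) k that, symmetric] that k
      by (auto simp: h_def co_p QP simp del: index_mult_mat(1))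
    have "h (p k) = 0"
      by (rule linear_eq_0_on_span[OF lin _ mem]) (use h k in auto)
    then show False using h[OF k] by simp
  qed
  have "x \<in> span (p ` {..<n})" for x
  proof -
    have "x = (\<Sum>k<n. (\<Sum>j<n. Q $$ (k, j) * co x j) *\<^sub>R p k)" (is "x = ?y")
    proof -
      have "co ?y i = co x i" if i: "i < n" for i
      proof -
        have "co ?y i = (\<Sum>k<n. \<Sum>j<n. P $$ (i, k) * Q $$ (k, j) * co x j)"
          using i by (simp add: co_simps co_p sum_distrib_left sum_distrib_right mult_ac)
        also have "\<dots> = (\<Sum>j<n. \<Sum>k<n. P $$ (i, k) * Q $$ (k, j) * co x j)"
          by (rule sum.swap)
        also have "\<dots> = (\<Sum>j<n. (P * Q) $$ (i, j) * co x j)"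
          using i carr by (intro sum.cong refl) (simp add: index_mult_mat_sum[of _ n n] sum_distrib_right del: index_mult_mat(1))
        also have "\<dots> = (\<Sum>j<n. if j = i then co x j else 0)"
          using i unfolding PQ by (intro sum.cong) auto
        finally show ?thesis using i by simp
      qed
      then have "(\<Sum>i<n. co ?y i *\<^sub>R bs ! i) = (\<Sum>i<n. co x i *\<^sub>R bs ! i)"
        by (intro sum.cong) auto
      then show ?thesis by (simp only: expand)
    qed
    also have "\<dots> \<in> span (p ` {..<n})"
      by (intro span_sum span_scale span_base) auto
    finally show ?thesis .
  qed
  then have span_p: "span (p ` {..<n}) = UNIV" by blast
  have "\<exists>u. (\<forall>k<n. u k \<noteq> 0 \<and> (\<forall>x. B (u k) x = T $$ (k, k) * E (u k) x)) \<and>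
      (\<forall>i<n. \<forall>j<n. i \<noteq> j \<longrightarrow> E (u i) (u j) = 0) \<and> span (u ` {..<n}) = span (p ` {..<n})"
    by (rule orthogonal_eigenvectors[where p = p and T = "\<lambda>i k. T $$ (i, k)" and n = n,
          OF bB bE symB symE posE triangular indep order.refl])
  then obtain u where u: "(\<forall>k<n. u k \<noteq> 0 \<and> (\<forall>x. B (u k) x = T $$ (k, k) * E (u k) x)) \<and>
      (\<forall>i<n. \<forall>j<n. i \<noteq> j \<longrightarrow> E (u i) (u j) = 0) \<and> span (u ` {..<n}) = span (p ` {..<n})" ..
  then have u0: "u k \<noteq> 0" and uB: "B (u k) x = T $$ (k, k) * E (u k) x" if "k < n" for k x
    using that by simp_all
  have uE: "E (u i) (u j) = 0" if "i < n" "j < n" "i \<noteq> j" for i j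
    using u that by simp
  have span_u: "span (u ` {..<n}) = UNIV"
    using u span_p by simp
  have diag: "T $$ (k, k) = (l # ns) ! k" if "k < n" for k
    using that carr unfolding T(2)[symmetric] diag_mat_def by simp
  have n: "0 < n" using len by auto
  have "B x x < 0" if x: "x \<noteq> 0" "B (u 0) x = 0" for x
  proof -
    define a where "a k = E x (u k) / E (u k) (u k)" for k
    define z where "z = x - (\<Sum>k<n. a k *\<^sub>R u k)"
    have sum_left: "F (\<Sum>k<n. a k *\<^sub>R u k) y = (\<Sum>k<n. a k * F (u k) y)"
      if F: "bilinear F" for F :: "'v \<Rightarrow> 'v \<Rightarrow> real" and y
    proof -
      have "linear (\<lambda>x. F x y)"
        using F by (simp add: bilinear_def)
      from linear_sum[OF this, of "\<lambda>k. a k *\<^sub>R u k" "{..<n}"] show ?thesis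
        by (simp add: bilinear_lmul[OF F])
    qed
    have Ez: "E z y = E x y - (\<Sum>k<n. a k * E (u k) y)" for y
      unfolding z_def bilinear_lsub[OF bE]
      by (simp add: sum_left[OF bE])
    have "E z (u j) = 0" if j: "j < n" for j
    proof -
      have "(\<Sum>k<n. a k * E (u k) (u j)) = (\<Sum>k<n. if k = j then E x (u j) else 0)"
        using j uE posE[OF u0[OF j]] by (intro sum.cong) (auto simp: a_def)
      then show ?thesis using j by (simp add: Ez)
    qed
    then have "E z z = 0"
      using linear_eq_0_on_span[of "E z" "u ` {..<n}" z] bE span_u by (auto simp: bilinear_def)
    then have "z = 0" using posE by force
    then have x_eq: "x = (\<Sum>k<n. a k *\<^sub>R u k)" by (simp add: z_def)
    have "B x x = (\<Sum>k<n. a k * B (u k) x)"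
      using sum_left[OF bB, of x] by (simp flip: x_eq)
    also have "\<dots> = (\<Sum>k<n. T $$ (k, k) * ((a k)\<^sup>2 * E (u k) (u k)))"
    proof (intro sum.cong refl)
      fix k assume "k \<in> {..<n}"
      then have k: "k < n" by simp
      have "E (u k) x = a k * E (u k) (u k)"
        using posE[OF u0[OF k]] by (simp add: a_def symE[of x])
      then show "a k * B (u k) x = T $$ (k, k) * ((a k)\<^sup>2 * E (u k) (u k))"
        by (simp add: uB[OF k] power2_eq_square)
    qed
    finally have Bxx: "B x x = (\<Sum>k<n. T $$ (k, k) * ((a k)\<^sup>2 * E (u k) (u k)))" .
    have a0: "a 0 = 0"
      using x(2) uB[OF n, of x] diag[OF n] l symE by (simp add: a_def)
    obtain k where k: "k < n" "a k \<noteq> 0"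
      using x(1) x_eq by (metis (mono_tags, lifting) lessThan_iff scaleR_zero_left sum.neutral)
    have neg: "T $$ (j, j) < 0" if "j < n" "j \<noteq> 0" for j
      using that diag[of j] ns len by (cases j) auto
    have "0 < (\<Sum>k<n. - (T $$ (k, k) * ((a k)\<^sup>2 * E (u k) (u k))))"
    proof (rule sum_pos2[where i = k])
      have "k \<noteq> 0" using k(2) a0 by metis
      then show "0 < - (T $$ (k, k) * ((a k)\<^sup>2 * E (u k) (u k)))"
        using neg[OF k(1)] k posE[OF u0[OF k(1)]] by (simp add: mult_neg_pos)
      show "0 \<le> - (T $$ (j, j) * ((a j)\<^sup>2 * E (u j) (u j)))" if "j \<in> {..<n}" for j
        using that neg[of j] posE[OF u0[of j]] a0
        by (cases "j = 0") (auto intro!: mult_nonpos_nonneg)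
    qed (use k in auto)
    then show ?thesis by (simp add: Bxx sum_negf)
  qed
  moreover have "B (u 0) (u 0) > 0"
    using uB[OF n] diag[OF n] l posE[OF u0[OF n]] by simp
  ultimately have "lorentzian_form B (u 0)"
    using bB symB by unfold_locales auto
  then show thesis by (rule that)
qed

section \<open>Matrices of endomorphisms and Gram matrices of sublattices\<close>

context
  fixes bs :: "'v::euclidean_space list" and f :: "'v \<Rightarrow> 'v"
  assumes basis: "distinct bs" "independent (set bs)" "span (set bs) = UNIV"
    and f: "linear f"
begin

lemma matrix_wrt_basis:
  assumes "j < length bs"
  shows "f (bs ! j) = (\<Sum>i<length bs. matrix_wrt bs f $$ (i, j) *\<^sub>R bs ! i)"
proof -
  have "f (bs ! j) = (\<Sum>i<length bs. representation (set bs) (f (bs ! j)) (bs ! i) *\<^sub>R bs ! i)"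
    by (rule sum_representation_list[OF basis, symmetric])
  also have "\<dots> = (\<Sum>i<length bs. matrix_wrt bs f $$ (i, j) *\<^sub>R bs ! i)"
    using assms by (intro sum.cong) (simp_all add: matrix_wrt_def)
  finally show ?thesis .
qed

lemma matrix_wrt_combination:
  "f (\<Sum>j<length bs. c j *\<^sub>R bs ! j)
    = (\<Sum>i<length bs. (\<Sum>j<length bs. matrix_wrt bs f $$ (i, j) * c j) *\<^sub>R bs ! i)"
proof -
  have "f (\<Sum>j<length bs. c j *\<^sub>R bs ! j)
      = (\<Sum>j<length bs. \<Sum>i<length bs. (matrix_wrt bs f $$ (i, j) * c j) *\<^sub>R bs ! i)"
    by (simp add: linear_sum[OF f] linear_scale[OF f] matrix_wrt_basis scaleR_sum_right mult.commute)
  also have "\<dots> = (\<Sum>i<length bs. \<Sum>j<length bs. (matrix_wrt bs f $$ (i, j) * c j) *\<^sub>R bs ! i)"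
    by (rule sum.swap)
  finally show ?thesis
    by (simp add: scaleR_sum_left)
qed

lemma linear_funpow: "linear (f ^^ k)"
proof (induction k)
  case 0
  show ?case by (simp add: linear_iff)
next
  case (Suc k)
  from linear_compose[OF this f] show ?case by (simp add: o_def)
qed

text \<open>
  Column \<open>j\<close> of \<open>(X - A) adj (X - A) = p\<close>, read coefficientwise, says that
  \<open>w\<^bsub>k-1\<^esub> - f w\<^sub>k = p\<^sub>k b\<^sub>j\<close>, where the vector \<open>w\<^sub>k\<close> has the coefficients of \<open>X\<^bsup>k\<^esup>\<close> in that column
  of the adjugate as coordinates. Applying \<open>f\<^bsup>k\<^esup>\<close> and summing over \<open>k\<close> gives a telescoping sum.
\<close>

lemma cayley_hamilton:
  defines "p \<equiv> char_poly (matrix_wrt bs f)"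
  shows "(\<Sum>k\<le>degree p. coeff p k *\<^sub>R (f ^^ k) u) = 0"
proof -
  define n where "n = length bs"
  define A where "A = matrix_wrt bs f"
  define C where "C = char_poly_matrix A"
  have A: "A \<in> carrier_mat n n"
    by (simp add: A_def matrix_wrt_def n_def)
  then have C: "C \<in> carrier_mat n n"
    by (simp add: C_def)
  define D where "D = adj_mat C"
  have D: "D \<in> carrier_mat n n" and CD: "C * D = p \<cdot>\<^sub>m 1\<^sub>m n"
    using adj_mat[OF C] by (simp_all add: D_def p_def char_poly_def C_def A_def)
  have Cij: "C $$ (i, j) = (if i = j then [:0, 1:] else 0) + [:- A $$ (i, j):]" if "i < n" "j < n" for i j
    using that A by (auto simp: C_def char_poly_matrix_def)
  have coeffs: "coeff (pCons 0 (D $$ (i, j))) k - (\<Sum>m<n. A $$ (i, m) * coeff (D $$ (m, j)) k)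
      = (if i = j then coeff p k else 0)" if ij: "i < n" "j < n" for i j k
  proof -
    have "(C * D) $$ (i, j) = (\<Sum>m<n. C $$ (i, m) * D $$ (m, j))"
      by (rule index_mult_mat_sum[OF C D ij])
    also have "\<dots> = (\<Sum>m<n. (if i = m then [:0, 1:] * D $$ (m, j) else 0) + [:- A $$ (i, m):] * D $$ (m, j))"
      using ij by (intro sum.cong refl) (simp add: Cij algebra_simps)
    also have "\<dots> = pCons 0 (D $$ (i, j)) + (\<Sum>m<n. [:- A $$ (i, m):] * D $$ (m, j))"
      unfolding sum.distrib using ij by simp
    finally have "coeff ((C * D) $$ (i, j)) k
        = coeff (pCons 0 (D $$ (i, j))) k - (\<Sum>m<n. A $$ (i, m) * coeff (D $$ (m, j)) k)"
      by (simp add: coeff_sum sum_negf)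
    then show ?thesis
      using ij unfolding CD by (auto split: if_splits)
  qed
  have basis_case: "(\<Sum>k\<le>degree p. coeff p k *\<^sub>R (f ^^ k) (bs ! j)) = 0" if j: "j < n" for j
  proof -
    define w where "w k = (\<Sum>i<n. coeff (D $$ (i, j)) k *\<^sub>R bs ! i)" for k
    \<comment> \<open>The sequence \<open>w\<close> shifted by one, with \<open>0\<close> in the place of the coefficient of index \<open>-1\<close>.\<close>
    define w' where "w' k = (case k of 0 \<Rightarrow> 0 | Suc l \<Rightarrow> w l)" for k
    have step: "coeff p k *\<^sub>R bs ! j = w' k - f (w k)" for k
    proof -
      have "w' k = (\<Sum>i<n. coeff (pCons 0 (D $$ (i, j))) k *\<^sub>R bs ! i)"
        by (simp add: w'_def w_def coeff_pCons split: nat.split)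
      moreover have "f (w k) = (\<Sum>i<n. (\<Sum>m<n. A $$ (i, m) * coeff (D $$ (m, j)) k) *\<^sub>R bs ! i)"
        unfolding w_def n_def A_def by (rule matrix_wrt_combination)
      ultimately have "w' k - f (w k) = (\<Sum>i<n. (if i = j then coeff p k else 0) *\<^sub>R bs ! i)"
        using j by (simp add: coeffs flip: sum_subtractf scaleR_diff_left)
      also have "\<dots> = (\<Sum>i<n. if i = j then coeff p k *\<^sub>R bs ! j else 0)"
        by (intro sum.cong) auto
      finally show ?thesis using j by simp
    qed
    define N where "N = Suc (degree p + (\<Sum>i<n. degree (D $$ (i, j))))"
    have "degree (D $$ (i, j)) < N" if "i < n" for i
      using member_le_sum[of i "{..<n}" "\<lambda>i. degree (D $$ (i, j))"] that by (simp add: N_def)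
    then have wN: "w N = 0"
      by (auto simp: w_def coeff_eq_0 intro!: sum.neutral)
    have telescope: "(\<Sum>k\<le>m. (f ^^ k) (w' k) - (f ^^ Suc k) (w k)) = - (f ^^ Suc m) (w m)" for m
      by (induction m) (simp_all add: w'_def linear_0[OF f])
    have "(\<Sum>k\<le>degree p. coeff p k *\<^sub>R (f ^^ k) (bs ! j)) = (\<Sum>k\<le>N. coeff p k *\<^sub>R (f ^^ k) (bs ! j))"
      by (intro sum.mono_neutral_left) (auto simp: N_def coeff_eq_0)
    also have "\<dots> = (\<Sum>k\<le>N. (f ^^ k) (w' k) - (f ^^ Suc k) (w k))"
    proof (intro sum.cong refl)
      fix k
      have "coeff p k *\<^sub>R (f ^^ k) (bs ! j) = (f ^^ k) (w' k - f (w k))"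
        by (simp add: linear_scale[OF linear_funpow] flip: step)
      then show "coeff p k *\<^sub>R (f ^^ k) (bs ! j) = (f ^^ k) (w' k) - (f ^^ Suc k) (w k)"
        by (simp add: linear_diff[OF linear_funpow] funpow_swap1)
    qed
    also have "\<dots> = - (f ^^ Suc N) (w N)"
      by (rule telescope)
    finally show ?thesis
      using wN linear_0[OF linear_funpow[of "Suc N"]] by simp
  qed
  have lin: "linear (\<lambda>u. \<Sum>k\<le>degree p. coeff p k *\<^sub>R (f ^^ k) u)"
    by (intro linear_compose_sum ballI linear_compose_scale_right linear_funpow)
  show ?thesis
    by (rule linear_eq_0_on_span[OF lin, of "set bs"])
       (use basis basis_case in \<open>auto simp: in_set_conv_nth n_def\<close>)
qed

lemma eigenvector_exists:
  assumes "poly (char_poly (matrix_wrt bs f)) l = 0"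
  obtains v where "v \<noteq> 0" "f v = l *\<^sub>R v"
proof -
  define n where "n = length bs"
  define A where "A = matrix_wrt bs f"
  have A: "A \<in> carrier_mat n n"
    by (simp add: A_def matrix_wrt_def n_def)
  obtain x where x: "x \<in> carrier_vec n" "x \<noteq> 0\<^sub>v n" "A *\<^sub>v x = l \<cdot>\<^sub>v x"
    using assms eigenvalue_root_char_poly[OF A, of l] A
    by (auto simp: eigenvalue_def eigenvector_def A_def)
  define v where "v = (\<Sum>j<n. vec_index x j *\<^sub>R bs ! j)"
  have "f v = (\<Sum>i<n. (\<Sum>j<n. A $$ (i, j) * vec_index x j) *\<^sub>R bs ! i)"
    unfolding v_def n_def A_def by (rule matrix_wrt_combination)
  also have "\<dots> = (\<Sum>i<n. (l * vec_index x i) *\<^sub>R bs ! i)"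
  proof (intro sum.cong refl)
    fix i assume "i \<in> {..<n}"
    then have i: "i < n" by simp
    have "(\<Sum>j<n. A $$ (i, j) * vec_index x j) = vec_index (A *\<^sub>v x) i"
      using i A x(1) by (simp add: scalar_prod_def atLeast0LessThan)
    then show "(\<Sum>j<n. A $$ (i, j) * vec_index x j) *\<^sub>R bs ! i = (l * vec_index x i) *\<^sub>R bs ! i"
      using i x(1) by (simp add: x(3))
  qed
  finally have "f v = l *\<^sub>R v"
    by (simp add: v_def scaleR_sum_right)
  moreover have "v \<noteq> 0"
  proof
    assume "v = 0"
    then have "vec_index x j = 0" if "j < n" for j
      using representation_list_sum[OF basis, of j "\<lambda>j. vec_index x j"] that
      by (simp add: v_def n_def real_vector.representation_zero)
    then have "x = 0\<^sub>v n"
      using x(1) by (intro eq_vecI) auto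
    with x(2) show False by simp
  qed
  ultimately show thesis by (intro that)
qed

end

lemma basis_in_lattice:
  assumes "lattice_basis L bs" "i < length bs" shows "bs ! i \<in> L"
proof -
  have "bs ! i = (\<Sum>j<length bs. of_int (if j = i then 1 else 0) *\<^sub>R bs ! j)"
  proof -
    have "(\<Sum>j<length bs. of_int (if j = i then 1 else 0) *\<^sub>R bs ! j)
        = (\<Sum>j<length bs. if j = i then bs ! i else 0)"
      by (intro sum.cong) auto
    then show ?thesis using assms(2) by simp
  qed
  then have "bs ! i \<in> range (\<lambda>c :: nat \<Rightarrow> int. \<Sum>j<length bs. of_int (c j) *\<^sub>R bs ! j)"
    by (rule range_eqI[where x = "\<lambda>j. if j = i then 1 else 0"])
  then show ?thesis
    using assms(1) by (simp add: lattice_basis_def)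
qed

lemma lattice_isometry_form:
  fixes B :: "'v::euclidean_space \<Rightarrow> 'v \<Rightarrow> real"
  assumes "bilinear B" "lattice_basis L bs" "lattice_isometry L B f"
  shows "B (f x) (f y) = B x y"
proof -
  have basis: "distinct bs" "independent (set bs)" "span (set bs) = UNIV"
    using assms(2) by (auto simp: lattice_basis_def)
  have f: "linear f" and iso: "\<And>x y. x \<in> L \<Longrightarrow> y \<in> L \<Longrightarrow> B (f x) (f y) = B x y"
    using assms(3) by (auto simp: lattice_isometry_def)
  have "bilinear (\<lambda>x y. B (f x) (f y))"
    using assms(1) f by (auto simp: bilinear_def intro!: linearI
      simp: linear_add[OF f] linear_scale[OF f] bilinear_ladd[OF assms(1)] bilinear_radd[OF assms(1)]
        bilinear_lmul[OF assms(1)] bilinear_rmul[OF assms(1)])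
  moreover have "B (f b) (f c) = B b c" if "b \<in> set bs" "c \<in> set bs" for b c
    using that basis_in_lattice[OF assms(2)] by (intro iso) (auto simp: in_set_conv_nth)
  ultimately show ?thesis
    by (intro bilinear_eq[where f = "\<lambda>x y. B (f x) (f y)" and g = B and S = UNIV and T = UNIV
        and B = "set bs" and C = "set bs" and x = x and y = y]) (simp_all add: basis(3) assms(1))
qed

text \<open>
  If \<open>K\<close> is the integer matrix of coordinates of the \<open>g i\<close> and \<open>G\<close> is the Gram matrix of the lattice, then
  the Gram matrix of the \<open>g i\<close> is \<open>K G K\<^sup>T\<close>.
\<close>

lemma sublattice_gram:
  fixes B :: "'v::euclidean_space \<Rightarrow> 'v \<Rightarrow> real" and g :: "nat \<Rightarrow> 'v"
  assumes "bilinear B" "lattice_basis L bs" "\<And>i. g i \<in> L"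
  defines "n \<equiv> length bs"
  shows "\<exists>k::int. Determinant.det (mat n n (\<lambda>(i, j). B (g i) (g j)))
    = (of_int k)\<^sup>2 * Determinant.det (gram_matrix B bs)"
proof -
  have "\<forall>i. \<exists>c :: nat \<Rightarrow> int. g i = (\<Sum>l<n. of_int (c l) *\<^sub>R bs ! l)"
    using assms(2,3) unfolding lattice_basis_def n_def by blast
  then obtain c :: "nat \<Rightarrow> nat \<Rightarrow> int" where c: "\<And>i. g i = (\<Sum>l<n. of_int (c i l) *\<^sub>R bs ! l)"
    by metis
  define K where "K = mat n n (\<lambda>(i, l). c i l)"
  define Kr where "Kr = map_mat real_of_int K"
  define G where "G = gram_matrix B bs"
  define M where "M = mat n n (\<lambda>(i, j). B (g i) (g j))"
  have carr: "Kr \<in> carrier_mat n n" "G \<in> carrier_mat n n" "Kr\<^sup>T \<in> carrier_mat n n"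
    by (auto simp: K_def Kr_def G_def gram_matrix_def n_def)
  have "M = Kr * (G * Kr\<^sup>T)"
  proof (rule eq_matI)
    fix i j assume "i < dim_row (Kr * (G * Kr\<^sup>T))" "j < dim_col (Kr * (G * Kr\<^sup>T))"
    then have ij: "i < n" "j < n" using carr by auto
    have GK: "(G * Kr\<^sup>T) $$ (l, j) = (\<Sum>m<n. B (bs ! l) (bs ! m) * c j m)" if "l < n" for l
    proof -
      have "(G * Kr\<^sup>T) $$ (l, j) = (\<Sum>m<n. G $$ (l, m) * Kr\<^sup>T $$ (m, j))"
        by (rule index_mult_mat_sum[OF carr(2,3) that ij(2)])
      also have "\<dots> = (\<Sum>m<n. B (bs ! l) (bs ! m) * c j m)"
        using that ij by (intro sum.cong refl) (simp add: G_def gram_matrix_def n_def Kr_def K_def)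
      finally show ?thesis .
    qed
    have "(Kr * (G * Kr\<^sup>T)) $$ (i, j) = (\<Sum>l<n. Kr $$ (i, l) * (G * Kr\<^sup>T) $$ (l, j))"
      using carr ij by (intro index_mult_mat_sum[of _ n n]) auto
    also have "\<dots> = (\<Sum>l<n. \<Sum>m<n. c i l * (B (bs ! l) (bs ! m) * c j m))"
    proof (rule sum.cong[OF refl])
      fix l assume "l \<in> {..<n}"
      then have l: "l < n" by simp
      show "Kr $$ (i, l) * (G * Kr\<^sup>T) $$ (l, j) = (\<Sum>m<n. c i l * (B (bs ! l) (bs ! m) * c j m))"
        unfolding GK[OF l] sum_distrib_left using l ij by (simp add: Kr_def K_def)
    qed
    also have "\<dots> = B (g i) (g j)"
      unfolding c bilinear_sum[OF assms(1)] sum.cartesian_product[symmetric]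
      by (simp add: bilinear_lmul[OF assms(1)] bilinear_rmul[OF assms(1)] mult_ac)
    finally show "M $$ (i, j) = (Kr * (G * Kr\<^sup>T)) $$ (i, j)"
      using ij by (simp add: M_def)
  qed (use carr in \<open>auto simp: M_def\<close>)
  then have "Determinant.det M = Determinant.det Kr * (Determinant.det G * Determinant.det Kr)"
    using carr by (simp add: det_mult[of _ n] det_transpose[of _ n])
  also have "Determinant.det Kr = of_int (Determinant.det K)"
    unfolding Kr_def by (rule of_int_hom.hom_det)
  finally show ?thesis
    by (intro exI[of _ "Determinant.det K"]) (simp add: M_def G_def power2_eq_square)
qed

section \<open>Salem polynomials\<close>

abbreviation complex_poly :: "rat poly \<Rightarrow> complex poly" where
  "complex_poly \<equiv> map_poly of_rat"

abbreviation complex_roots :: "rat poly \<Rightarrow> complex set" where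
  "complex_roots s \<equiv> {z. poly (complex_poly s) z = 0}"

interpretation complex_poly_hom: map_poly_inj_comm_ring_hom "of_rat :: rat \<Rightarrow> complex" ..

lemma of_real_of_rat: "complex_of_real (of_rat q) = of_rat q"
  by (cases q) (simp add: of_rat_rat)

text \<open>
  A minimal polynomial is a prime element, so its greatest common divisor with \<open>q\<close>, which has the root \<open>a\<close>
  and is thus not constant, is \<open>s\<close> itself.
\<close>

lemma minimal_polynomial_conjugate:
  assumes min: "minimal_polynomial x s" and a: "poly (complex_poly s) a = 0"
    and q: "poly (complex_poly q) a = 0"
  shows "s dvd q"
proof -
  have monic: "lead_coeff s = 1" and iff: "\<And>q. poly (complex_poly q) x = 0 \<longleftrightarrow> s dvd q"
    using min by (auto simp: minimal_polynomial_def)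
  have prime: "s dvd g \<or> s dvd h" if "s dvd g * h" for g h
    using that by (simp add: complex_poly_hom.hom_mult flip: iff)
  interpret of_rat: field_hom' "of_rat :: rat \<Rightarrow> complex" ..
  define d where "d = gcd s q"
  have "[:- a, 1:] dvd gcd (complex_poly s) (complex_poly q)"
    using a q by (simp add: poly_eq_0_iff_dvd)
  then have "[:- a, 1:] dvd complex_poly d"
    by (simp only: d_def of_rat.map_poly_gcd)
  then have da: "poly (complex_poly d) a = 0"
    by (simp add: poly_eq_0_iff_dvd)
  obtain e where e: "s = d * e"
    unfolding d_def by (meson dvdE gcd_dvd1)
  show ?thesis
  proof (cases "s dvd d")
    case True
    then show ?thesis
      unfolding d_def by (meson dvd_trans gcd_dvd2)
  next
    case False
    have "s dvd d * e"
      by (subst e[symmetric]) (rule dvd_refl)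
    with prime[of d e] False have "s dvd e"
      by blast
    then obtain g where g: "e = s * g" ..
    have "s * 1 = s * (d * g)"
      using e unfolding g by (simp add: mult_ac)
    then have "d * g = 1"
      using monic by (subst (asm) mult_cancel_left) auto
    then have "poly (complex_poly (d * g)) a = 1"
      by simp
    with da show ?thesis
      by (simp add: complex_poly_hom.hom_mult)
  qed
qed

lemma minimal_polynomial_monic: "minimal_polynomial x s \<Longrightarrow> lead_coeff s = 1"
  by (simp add: minimal_polynomial_def)

lemma minimal_polynomial_root: "minimal_polynomial x s \<Longrightarrow> poly (complex_poly s) x = 0"
  by (simp add: minimal_polynomial_def)

lemma minimal_polynomial_dvd:
  "minimal_polynomial x s \<Longrightarrow> poly (complex_poly q) x = 0 \<Longrightarrow> s dvd q"
  by (simp add: minimal_polynomial_def)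

lemma minimal_polynomial_unique:
  assumes "minimal_polynomial x p" "minimal_polynomial x s" shows "p = s"
proof (rule poly_dvd_antisym)
  show "coeff p (degree p) = coeff s (degree s)"
    using assms[THEN minimal_polynomial_monic] by simp
  show "p dvd s"
    by (rule minimal_polynomial_dvd[OF assms(1) minimal_polynomial_root[OF assms(2)]])
  show "s dvd p"
    by (rule minimal_polynomial_dvd[OF assms(2) minimal_polynomial_root[OF assms(1)]])
qed

lemma minimal_polynomial_degree:
  assumes "minimal_polynomial x s" shows "degree s > 0"
proof (rule ccontr)
  assume "\<not> degree s > 0"
  then have "s = 1"
    using minimal_polynomial_monic[OF assms] by (auto elim!: degree_eq_zeroE)
  then show False
    using minimal_polynomial_root[OF assms] by simp
qed

text \<open>
  A common root with the derivative would make \<open>s\<close> divide its own derivative.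
\<close>

lemma minimal_polynomial_rsquarefree:
  assumes min: "minimal_polynomial x s"
  shows "rsquarefree (complex_poly s)"
proof -
  have "poly (pderiv (complex_poly s)) a \<noteq> 0" if a: "poly (complex_poly s) a = 0" for a
  proof
    assume "poly (pderiv (complex_poly s)) a = 0"
    then have "poly (complex_poly (pderiv s)) a = 0"
      by (simp only: of_rat_hom.map_poly_pderiv)
    then have "s dvd pderiv s"
      by (rule minimal_polynomial_conjugate[OF min a])
    moreover have "pderiv s \<noteq> 0"
      using minimal_polynomial_degree[OF min] by (simp add: pderiv_eq_0_iff)
    ultimately have "degree s \<le> degree (pderiv s)"
      by (rule dvd_imp_degree_le)
    then show False
      using minimal_polynomial_degree[OF min] by (simp add: degree_pderiv)
  qed
  then show ?thesis
    unfolding rsquarefree_roots by blast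
qed

lemma complex_poly_eq_prod:
  assumes min: "minimal_polynomial x s"
  shows "complex_poly s = (\<Prod>a\<in>complex_roots s. [:- a, 1:])"
  using complex_poly_decompose_rsquarefree[OF minimal_polynomial_rsquarefree[OF min]]
    minimal_polynomial_monic[OF min]
  by simp

lemma finite_complex_roots:
  assumes "minimal_polynomial x s" shows "finite (complex_roots s)"
  using minimal_polynomial_degree[OF assms] by (intro poly_roots_finite) auto

lemma card_complex_roots:
  assumes "minimal_polynomial x s" shows "card (complex_roots s) = degree s"
proof -
  have "degree (complex_poly s) = card (complex_roots s)"
    by (subst complex_poly_eq_prod[OF assms])
       (rule monic_prod_linear(1)[OF finite_complex_roots[OF assms]])
  then show ?thesis by simp
qed

lemma norm_discr:
  assumes min: "minimal_polynomial x s"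
  shows "cmod (discr s) = (\<Prod>a\<in>complex_roots s. \<Prod>b\<in>complex_roots s - {a}. cmod (a - b))"
proof -
  let ?R = "complex_roots s"
  note fin = finite_complex_roots[OF min]
  have s0: "complex_poly s \<noteq> 0"
    using minimal_polynomial_degree[OF min] by auto
  have proots: "proots (complex_poly s) = mset_set ?R"
  proof (rule multiset_eqI)
    fix a
    show "count (proots (complex_poly s)) a = count (mset_set ?R) a"
      using rsquarefree_root_order[OF minimal_polynomial_rsquarefree[OF min] _ s0, of a] s0 fin
      by (cases "poly (complex_poly s) a = 0") (auto simp: order_root)
  qed
  have "cmod (discr s) = cmod (\<Prod>a\<in>#mset_set ?R. \<Prod>b\<in>#mset_set ?R - {#a#}. a - b)"
    unfolding discr_def Let_def proots using minimal_polynomial_monic[OF min] by (simp add: norm_mult norm_power)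
  also have "(\<Prod>a\<in>#mset_set ?R. \<Prod>b\<in>#mset_set ?R - {#a#}. a - b)
      = (\<Prod>a\<in>?R. \<Prod>b\<in>#mset_set ?R - {#a#}. a - b)"
    by (simp add: prod_unfold_prod_mset)
  also have "\<dots> = (\<Prod>a\<in>?R. \<Prod>b\<in>?R - {a}. a - b)"
  proof (rule prod.cong[OF refl])
    fix a assume "a \<in> ?R"
    then have "mset_set ?R - {#a#} = mset_set (?R - {a})"
      using fin by (simp add: mset_set_Diff)
    then show "(\<Prod>b\<in>#mset_set ?R - {#a#}. a - b) = (\<Prod>b\<in>?R - {a}. a - b)"
      by (simp add: prod_unfold_prod_mset)
  qed
  finally show ?thesis
    by (simp add: prod_norm[symmetric])
qed

lemma salem_roots:
  assumes "salem_polynomial s"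
  obtains l :: real where "minimal_polynomial (of_real l) s" "l > 1"
    "of_real l \<in> complex_roots s" "of_real (1 / l) \<in> complex_roots s"
    "\<And>a. a \<in> complex_roots s \<Longrightarrow> a \<noteq> of_real l \<Longrightarrow> a \<noteq> of_real (1 / l) \<Longrightarrow> norm a = 1"
    "0 \<notin> complex_roots s" "(\<Prod>a\<in>complex_roots s. norm a) = 1"
proof -
  obtain l where salem: "salem_number l" and min: "minimal_polynomial (of_real l) s"
    using assms by (auto simp: salem_polynomial_def)
  let ?R = "complex_roots s"
  have conj: "galois_conjugate (of_real l) z \<longleftrightarrow> z \<in> ?R" for z
  proof
    assume "galois_conjugate (of_real l) z"
    then obtain p where "minimal_polynomial (of_real l) p" "poly (complex_poly p) z = 0"
      unfolding galois_conjugate_def by (elim exE conjE)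
    then show "z \<in> ?R"
      using minimal_polynomial_unique[OF _ min, of p] by simp
  next
    assume "z \<in> ?R"
    then show "galois_conjugate (of_real l) z"
      unfolding galois_conjugate_def using min by (intro exI[of _ s]) simp
  qed
  have l: "l > 1" and conj_inv: "galois_conjugate (of_real l) (of_real (1 / l))"
    and conj_unit: "\<forall>z. galois_conjugate (of_real l) z \<and> z \<noteq> of_real l \<and> z \<noteq> of_real (1 / l) \<longrightarrow> norm z = 1"
    using salem unfolding salem_number_def by simp_all
  have R: "of_real (1 / l) \<in> ?R" "of_real l \<in> ?R"
    and unit: "\<And>a. a \<in> ?R \<Longrightarrow> a \<noteq> of_real l \<Longrightarrow> a \<noteq> of_real (1 / l) \<Longrightarrow> norm a = 1"
    using conj_inv conj_unit minimal_polynomial_root[OF min] unfolding conj by simp_all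
  have "0 \<notin> ?R"
    using unit[of 0] l by auto
  moreover have "(\<Prod>a\<in>?R. norm a) = 1"
  proof -
    have neq: "complex_of_real l \<noteq> of_real (1 / l)"
      using l unfolding of_real_eq_iff by (auto simp: field_simps) (metis less_1_mult less_irrefl)
    have "(\<Prod>a\<in>?R. norm a) = (\<Prod>a\<in>{complex_of_real l, of_real (1 / l)}. norm a)"
      using R unit by (intro prod.mono_neutral_right finite_complex_roots[OF min]) auto
    also have "\<dots> = norm (complex_of_real l) * norm (complex_of_real (1 / l))"
      using neq by (subst prod.insert) auto
    also have "\<dots> = 1"
      using l by (simp only: norm_of_real) simp
    finally show ?thesis .
  qed
  ultimately show thesis
    using that[OF min l R(2) R(1) unit] by simp
qed

text \<open>
  By Horner's scheme \<open>c\<^sub>a\<close> is, up to a nonzero factor, the value at \<open>a\<close> of a polynomial \<open>h\<close> that has rational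
  coefficients and does not depend on \<open>a\<close>. Its degree is smaller than that of \<open>s\<close>, and its leading
  coefficient is \<open>B r r \<noteq> 0\<close>. Hence \<open>h\<close> does not vanish at a root of the irreducible polynomial \<open>s\<close>.
\<close>

lemma (in lorentzian_isometry) coefficient_nonzero:
  assumes min: "minimal_polynomial x s" and R: "R = complex_roots s" and a: "a \<in> R"
    and int: "\<And>k. B ((f ^^ k) r) r \<in> \<int>" and r: "B r r \<noteq> 0"
  shows "pairing B f (L a) r r \<noteq> 0"
proof
  assume zero: "pairing B f (L a) r r = 0"
  define n where "n = degree s"
  define q where "q = (\<Prod>b\<in>R-{a}. [:- b, 1:])"
  have n: "0 < n"
    unfolding n_def by (rule minimal_polynomial_degree[OF min])
  have "complex_poly s = (\<Prod>b\<in>R. [:- b, 1:])"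
    unfolding R by (rule complex_poly_eq_prod[OF min])
  also have "\<dots> = [:- a, 1:] * q"
    unfolding q_def by (rule prod.remove[OF finite_R a])
  finally have P: "complex_poly s = [:- a, 1:] * q" .
  have deg: "degree q = n - 1"
    using monic_prod_linear(1)[of "R - {a}" "\<lambda>x. x"] a finite_R card_complex_roots[OF min]
    by (simp add: q_def n_def R)
  have "\<forall>k. \<exists>z::int. B ((f ^^ k) r) r = of_int z"
    using int by (auto elim!: Ints_cases)
  then obtain z :: "nat \<Rightarrow> int" where z: "\<And>k. B ((f ^^ k) r) r = of_int (z k)"
    by metis
  \<comment> \<open>Horner's scheme writes the coefficients of \<open>q\<close> as polynomials in \<open>a\<close>; collecting powers gives \<open>h\<close>.\<close>
  define h :: "rat poly" where
    "h = (\<Sum>i<n. \<Sum>j=i..<n. monom (coeff s (Suc j) * of_int (z i)) (j - i))"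
  have "L a = Polynomial.smult (1 / (\<Prod>b\<in>R-{a}. a - b)) q"
    by (simp add: lagrange_def q_def)
  moreover have "(\<Prod>b\<in>R-{a}. a - b) \<noteq> 0"
    using finite_R by simp
  ultimately have "0 = pairing B f q r r"
    using zero by (simp add: pairing_smult)
  also have "\<dots> = (\<Sum>i<n. coeff q i * of_int (z i))"
    using n by (simp add: pairing_def deg z lessThan_Suc_atMost[symmetric])
  also have "\<dots> = (\<Sum>i<n. \<Sum>j=i..<n. of_rat (coeff s (Suc j) * of_int (z i)) * a ^ (j - i))"
  proof (rule sum.cong[OF refl])
    fix i assume "i \<in> {..<n}"
    then have "coeff q i = (\<Sum>j=i..<n. coeff (complex_poly s) (Suc j) * a ^ (j - i))"
      using deg n by (intro coeff_linear_quotient[OF P]) auto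
    then show "coeff q i * of_int (z i)
        = (\<Sum>j=i..<n. of_rat (coeff s (Suc j) * of_int (z i)) * a ^ (j - i))"
      by (simp add: sum_distrib_left sum_distrib_right of_rat_mult mult_ac)
  qed
  also have "\<dots> = poly (complex_poly h) a"
    by (simp add: h_def complex_poly_hom.hom_sum poly_sum poly_monom)
  finally have "s dvd h"
    using minimal_polynomial_conjugate[OF min, of a h] a R by simp
  moreover have "coeff h (n - 1) \<noteq> 0"
  proof -
    have "coeff h (n - 1) = (\<Sum>i<n. \<Sum>j=i..<n. if j - i = n - 1 then coeff s (Suc j) * of_int (z i) else 0)"
      by (simp add: h_def coeff_sum)
    also have "\<dots> = (\<Sum>i<n. if i = 0 then of_int (z 0) else 0)"
    proof (rule sum.cong[OF refl])
      fix i assume "i \<in> {..<n}"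
      show "(\<Sum>j=i..<n. if j - i = n - 1 then coeff s (Suc j) * of_int (z i) else 0)
          = (if i = 0 then of_int (z 0) else (0::rat))"
      proof (cases "i = 0")
        case True
        have "coeff s n = 1"
          using minimal_polynomial_monic[OF min] by (simp add: n_def)
        then show ?thesis
          using True n by simp
      next
        case False
        then have "j - i \<noteq> n - 1" if "i \<le> j" "j < n" for j
          using that by auto
        then show ?thesis
          using False by (auto intro!: sum.neutral)
      qed
    qed
    also have "\<dots> = of_int (z 0)"
      using n by simp
    finally have "coeff h (n - 1) = of_int (z 0)" .
    moreover have "z 0 \<noteq> 0"
      using z[of 0] r by auto
    ultimately show ?thesis by simp
  qed
  moreover have "degree h \<le> n - 1"
    unfolding h_def by (intro degree_sum_le order.trans[OF degree_monom_le]) auto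
  moreover from calculation(2) have "h \<noteq> 0"
    by (metis coeff_0)
  ultimately show False
    using dvd_imp_degree_le[of s h] n by (simp add: n_def)
qed

section \<open>The axis and the chamber around it\<close>

text \<open>
  The image of the component is connected, and it meets the component in \<open>h x\<close>, which \<open>A\<close> joins to \<open>x\<close>.
\<close>

lemma linear_image_component_subset:
  fixes h :: "'v::euclidean_space \<Rightarrow> 'v"
  assumes "linear h" "h ` S \<subseteq> S" "connected A" "A \<subseteq> S" "x \<in> A" "h x \<in> A"
  shows "h ` connected_component_set S x \<subseteq> connected_component_set S x"
proof -
  let ?C = "connected_component_set S x"
  have x: "x \<in> S" using assms by auto
  have "connected (h ` ?C)"
    by (intro connected_continuous_image linear_continuous_on connected_connected_component)
       (simp add: assms(1) linear_conv_bounded_linear[symmetric])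
  moreover have "h ` ?C \<subseteq> S"
    using assms(2) connected_component_subset[of S x] by blast
  moreover have "h x \<in> h ` ?C"
    using x by (simp add: connected_component_refl)
  ultimately have "h ` ?C \<subseteq> connected_component_set S (h x)"
    by (intro connected_component_maximal)
  moreover have "A \<subseteq> ?C"
    using assms by (intro connected_component_maximal)
  then have "connected_component_set S (h x) = ?C"
    using assms(6) connected_component_eq by blast
  ultimately show ?thesis by simp
qed

lemma (in lorentzian_isometry) inj_isometry: "inj f"
proof (rule linear_injective_0[OF lin, THEN iffD2], intro allI impI)
  fix x assume "f x = 0"
  then have "B x y = 0" for y
    using isometry[of x y] by (simp add: form_simps)
  then show "x = 0"
    by (rule nondegenerate)
qed

text \<open>
  The chamber is the component of \<open>v + w\<close>. Both \<open>f\<close> and its inverse preserve the axis and the union of the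
  chambers, so each of them maps this component into itself.
\<close>

lemma chamber_through_axis:
  fixes B :: "'v::euclidean_space \<Rightarrow> 'v \<Rightarrow> real"
  assumes "lorentzian_isometry B e f R" and N: "lattice_isometry N B f"
    and l: "l > 0" "l\<^sup>2 \<noteq> 1" and v: "f v = l *\<^sub>R v" and w: "f w = (1 / l) *\<^sub>R w" and vw: "B v w > 0"
    and roots: "\<And>r. r \<in> lattice_roots N B \<Longrightarrow> B r v * B r w > 0"
  shows "\<exists>C\<in>chambers N B. f ` C = C"
proof -
  interpret lorentzian_isometry B e f R by fact
  define S where "S = {x. B x x > 0 \<and> (\<forall>r\<in>lattice_roots N B. B r x \<noteq> 0)}"
  define A where "A = {x. \<exists>a>0. \<exists>b>0. x = a *\<^sub>R v + b *\<^sub>R w}"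
  have iso: "B v v = 0" "B w w = 0"
    using eigenvector_isotropic[OF v] eigenvector_isotropic[OF w] l by (auto simp: power_divide)
  have AI: "a *\<^sub>R v + b *\<^sub>R w \<in> A" if "a > 0" "b > 0" for a b
    using that by (auto simp: A_def)
  have "convex A"
    unfolding convex_alt
  proof (intro ballI allI impI)
    fix x y and t :: real
    assume "x \<in> A" "y \<in> A" and t: "0 \<le> t \<and> t \<le> 1"
    then obtain a b a' b' where ab: "a > 0" "b > 0" "x = a *\<^sub>R v + b *\<^sub>R w"
      and ab': "a' > 0" "b' > 0" "y = a' *\<^sub>R v + b' *\<^sub>R w"
      by (auto simp: A_def)
    have pos: "(1 - t) * c + t * c' > 0" if "c > 0" "c' > 0" for c c'
      using t that by (cases "t = 0") (auto intro!: add_nonneg_pos)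
    have "(1 - t) *\<^sub>R x + t *\<^sub>R y = ((1 - t) * a + t * a') *\<^sub>R v + ((1 - t) * b + t * b') *\<^sub>R w"
      unfolding ab ab' by (simp add: algebra_simps)
    then show "(1 - t) *\<^sub>R x + t *\<^sub>R y \<in> A"
      using AI[OF pos[OF ab(1) ab'(1)] pos[OF ab(2) ab'(2)]] by simp
  qed
  then have conn: "connected A"
    by (rule convex_connected)
  have AS: "A \<subseteq> S"
  proof
    fix x assume "x \<in> A"
    then obtain a b where ab: "a > 0" "b > 0" "x = a *\<^sub>R v + b *\<^sub>R w"
      by (auto simp: A_def)
    have "B x x = 2 * (a * b * B v w)"
      using iso sym[of w v] by (simp add: ab(3) form_simps)
    then have "B x x > 0"
      using ab vw by simp
    moreover have "B r x \<noteq> 0" if "r \<in> lattice_roots N B" for r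
    proof -
      have "B r v > 0 \<and> B r w > 0 \<or> B r v < 0 \<and> B r w < 0"
        using roots[OF that] by (simp add: zero_less_mult_iff)
      moreover have "B r x = a * B r v + b * B r w"
        by (simp add: ab(3) form_simps)
      ultimately show ?thesis
        using ab mult_pos_pos[of a "B r v"] mult_pos_pos[of b "B r w"]
          mult_pos_neg[of a "B r v"] mult_pos_neg[of b "B r w"] by linarith
    qed
    ultimately show "x \<in> S"
      by (simp add: S_def)
  qed
  define g where "g = inv_into UNIV f"
  have bij: "bij f"
    using linear_injective_imp_surjective[OF lin inj_isometry] inj_isometry by (simp add: bij_def)
  have fg: "f (g x) = x" and gf: "g (f x) = x" for x
    using bij by (simp_all add: g_def bij_is_surj surj_f_inv_f bij_is_inj)
  have g: "linear g"
    using inj_linear_imp_inv_linear[OF lin inj_isometry] by (simp add: g_def)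
  have bijN: "bij_betw f N N"
    using N by (simp add: lattice_isometry_def)
  have f_roots: "f r \<in> lattice_roots N B" if "r \<in> lattice_roots N B" for r
    using that bij_betwE[OF bijN] by (auto simp: lattice_roots_def isometry)
  have g_roots: "g r \<in> lattice_roots N B" if "r \<in> lattice_roots N B" for r
  proof -
    have "r \<in> f ` N"
      using that bijN by (simp add: lattice_roots_def bij_betw_def)
    then have "g r \<in> N"
      using gf by auto
    moreover have "B (g r) (g r) = B r r"
      using isometry[of "g r" "g r"] by (simp add: fg)
    ultimately show ?thesis
      using that by (simp add: lattice_roots_def)
  qed
  have fS: "f ` S \<subseteq> S"
  proof
    fix y assume "y \<in> f ` S"
    then obtain x where x: "y = f x" "x \<in> S" by blast
    have "B r (f x) \<noteq> 0" if "r \<in> lattice_roots N B" for r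
      using x(2) g_roots[OF that] isometry[of "g r" x] by (auto simp: S_def fg)
    then show "y \<in> S"
      using x by (simp add: S_def isometry)
  qed
  have gS: "g ` S \<subseteq> S"
  proof
    fix y assume "y \<in> g ` S"
    then obtain x where x: "y = g x" "x \<in> S" by blast
    have "B r (g x) \<noteq> 0" if "r \<in> lattice_roots N B" for r
      using x(2) f_roots[OF that] isometry[of r "g x"] by (auto simp: S_def fg)
    moreover have "B (g x) (g x) = B x x"
      using isometry[of "g x" "g x"] by (simp add: fg)
    ultimately show "y \<in> S"
      using x by (simp add: S_def)
  qed
  have vwA: "v + w \<in> A"
    using AI[of 1 1] by simp
  have fA: "f (v + w) \<in> A"
    using AI[of l "1 / l"] l by (simp add: linear_add[OF lin] v w)
  have gA: "g (v + w) \<in> A"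
  proof -
    have "f ((1 / l) *\<^sub>R v + l *\<^sub>R w) = v + w"
      using l by (simp add: linear_add[OF lin] linear_scale[OF lin] v w)
    then have "g (v + w) = (1 / l) *\<^sub>R v + l *\<^sub>R w"
      using gf by metis
    then show ?thesis
      using AI[of "1 / l" l] l by simp
  qed
  define C where "C = connected_component_set S (v + w)"
  have fC: "f ` C \<subseteq> C"
    unfolding C_def by (rule linear_image_component_subset[OF lin fS conn AS vwA fA])
  have gC: "g ` C \<subseteq> C"
    unfolding C_def by (rule linear_image_component_subset[OF g gS conn AS vwA gA])
  have "C \<subseteq> f ` C"
  proof
    fix x assume "x \<in> C"
    then have "g x \<in> C" using gC by auto
    then show "x \<in> f ` C" using fg by (metis imageI)
  qed
  with fC have "f ` C = C" by blast
  moreover have "C \<in> chambers N B"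
    unfolding chambers_def S_def[symmetric] C_def
    using vwA AS by (intro componentsI) auto
  ultimately show ?thesis by blast
qed

text \<open>
  Otherwise the Gram determinant of the orbit of \<open>r\<close> would be a nonzero multiple of the determinant of the
  lattice by the square of an integer, and at the same time at most the discriminant in absolute value.
\<close>

lemma root_does_not_separate_axis:
  fixes B :: "'v::euclidean_space \<Rightarrow> 'v \<Rightarrow> real"
  assumes lattice: "lattice_basis N bs" "integral_lattice N B" "lattice_isometry N B f"
    and iso: "lorentzian_isometry B e f (complex_roots s)"
    and min: "minimal_polynomial (of_real l) s" and rank: "degree s = length bs"
    and l: "l > 1" "of_real l \<in> complex_roots s" "of_real (1 / l) \<in> complex_roots s"
    and unit: "\<And>a. a \<in> complex_roots s \<Longrightarrow> a \<noteq> of_real l \<Longrightarrow> a \<noteq> of_real (1 / l) \<Longrightarrow> norm a = 1"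
    and norm: "(\<Prod>a\<in>complex_roots s. norm a) = 1"
    and v: "f v = l *\<^sub>R v" and w: "f w = (1 / l) *\<^sub>R w" and vw: "B v w > 0"
    and det: "\<bar>Determinant.det (gram_matrix B bs)\<bar> > cmod (discr s)"
    and r: "r \<in> lattice_roots N B"
  shows "B r v * B r w > 0"
proof (rule ccontr)
  assume "\<not> B r v * B r w > 0"
  then have sep: "B r v * B r w \<le> 0" by simp
  interpret lorentzian_isometry B e f "complex_roots s" by fact
  have rN: "r \<in> N" and rr: "B r r = -2"
    using r by (simp_all add: lattice_roots_def)
  have bijN: "bij_betw f N N"
    using lattice(3) by (simp add: lattice_isometry_def)
  have fN: "(f ^^ k) r \<in> N" for k
    using rN bij_betwE[OF bijN] by (induction k) auto
  let ?R = "complex_roots s"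
  define n where "n = length bs"
  define M where "M = mat n n (\<lambda>(i, j). B ((f ^^ i) r) ((f ^^ j) r))"
  obtain k :: int where k: "Determinant.det M = (of_int k)\<^sup>2 * Determinant.det (gram_matrix B bs)"
    using sublattice_gram[OF bilinear lattice(1) fN] unfolding M_def n_def ..
  have detM: "\<bar>Determinant.det M\<bar> = (\<Prod>a\<in>?R. norm (pairing B f (L a) r r)) * cmod (discr s)"
    using norm_det_orbit_gram[OF norm, of r] card_complex_roots[OF min] rank
    by (simp add: norm_discr[OF min] M_def n_def)
  have prod_le: "(\<Prod>a\<in>?R. norm (pairing B f (L a) r r)) \<le> 1"
    by (rule prod_coefficients_le_1[OF l(2,3,1) unit v w vw rr sep])
  have "B ((f ^^ j) r) r \<in> \<int>" for j
    using lattice(2) fN rN by (simp add: integral_lattice_def)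
  then have "pairing B f (L a) r r \<noteq> 0" if "a \<in> ?R" for a
    using coefficient_nonzero[OF min refl that, of r] rr by simp
  moreover have "cmod (discr s) \<noteq> 0"
    unfolding norm_discr[OF min] using finite_R by simp
  ultimately have "Determinant.det M \<noteq> 0"
    using detM finite_R by auto
  then have "k \<noteq> 0"
    using k by auto
  then have "1 \<le> k\<^sup>2"
    by (simp add: int_one_le_iff_zero_less)
  then have "1 \<le> (real_of_int k)\<^sup>2"
    by (metis of_int_1_le_iff of_int_power)
  then have "\<bar>Determinant.det (gram_matrix B bs)\<bar> \<le> \<bar>Determinant.det M\<bar>"
    unfolding k abs_mult by (simp add: mult_le_cancel_right1)
  also have "\<dots> \<le> cmod (discr s)"
    unfolding detM using prod_le by (simp add: mult_left_le_one_le prod_nonneg)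
  finally show False using det by simp
qed

lemma salem_lorentzian_isometry:
  fixes B :: "'v::euclidean_space \<Rightarrow> 'v \<Rightarrow> real"
  assumes "lorentzian_form B e" and bs: "lattice_basis N bs" and N: "lattice_isometry N B f"
    and char: "char_poly (matrix_wrt bs f) = map_poly of_rat s"
    and min: "minimal_polynomial x s" and nz: "0 \<notin> complex_roots s"
  shows "lorentzian_isometry B e f (complex_roots s)"
proof -
  interpret lorentzian_form B e by fact
  have basis: "distinct bs" "independent (set bs)" "span (set bs) = UNIV"
    using bs by (auto simp: lattice_basis_def)
  have f: "linear f"
    using N by (simp add: lattice_isometry_def)
  show ?thesis
  proof (intro lorentzian_isometry.intro lorentzian_isometry_axioms.intro)
    show "lorentzian_form B e" by fact
    show "linear f" by (rule f)
    show "B (f x) (f y) = B x y" for x y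
      by (rule lattice_isometry_form[OF bilinear bs N])
    show "finite (complex_roots s)"
      by (rule finite_complex_roots[OF min])
    show "complex_roots s \<noteq> {}"
      using minimal_polynomial_root[OF min] by auto
    show "0 \<notin> complex_roots s" by (rule nz)
    fix u w
    have "pairing B f (complex_poly s) u w
        = of_real (B (\<Sum>k\<le>degree s. of_rat (coeff s k) *\<^sub>R (f ^^ k) u) w)"
      by (simp add: pairing_def form_sum_left form_simps of_real_of_rat)
    also have "(\<Sum>k\<le>degree s. of_rat (coeff s k) *\<^sub>R (f ^^ k) u) = 0"
      using cayley_hamilton[OF basis f, of u] unfolding char by simp
    finally have "pairing B f (complex_poly s) u w = 0"
      by (simp add: form_simps)
    then show "pairing B f (\<Prod>a\<in>complex_roots s. [:- a, 1:]) u w = 0"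
      by (simp only: complex_poly_eq_prod[OF min, symmetric])
  qed
qed

theorem proposition4p3:
  fixes N :: "'v::euclidean_space set"
    and B :: "'v \<Rightarrow> 'v \<Rightarrow> real"
    and bs :: "'v list"
    and f :: "'v \<Rightarrow> 'v"
    and s :: "rat poly"
  assumes "even_lattice N B"
    and "hyperbolic_lattice N B"
    and "lattice_basis N bs"
    and "lattice_isometry N B f"
    and "char_poly (matrix_wrt bs f) = map_poly of_rat s"
    and "salem_polynomial s"
    and "\<bar>Determinant.det (gram_matrix B bs)\<bar> > 4 * cmod (discr s)"
  shows "\<exists>C \<in> chambers N B. f ` C = C"
proof -
  obtain l :: real where min: "minimal_polynomial (of_real l) s" and l: "l > 1"
      "of_real l \<in> complex_roots s" "of_real (1 / l) \<in> complex_roots s"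
    and unit: "\<And>a. a \<in> complex_roots s \<Longrightarrow> a \<noteq> of_real l \<Longrightarrow> a \<noteq> of_real (1 / l) \<Longrightarrow> norm a = 1"
    and nz: "0 \<notin> complex_roots s" and norm: "(\<Prod>a\<in>complex_roots s. norm a) = 1"
    by (rule salem_roots[OF assms(6)], rule that)
  obtain e where e: "lorentzian_form B e"
    by (rule hyperbolic_imp_lorentzian[OF assms(2)])
  have iso: "lorentzian_isometry B e f (complex_roots s)"
    by (rule salem_lorentzian_isometry[OF e assms(3,4,5) min nz])
  then interpret lorentzian_isometry B e f "complex_roots s" .
  have basis: "distinct bs" "independent (set bs)" "span (set bs) = UNIV"
    using assms(3) by (auto simp: lattice_basis_def)
  have root: "poly (char_poly (matrix_wrt bs f)) x = 0" if "of_real x \<in> complex_roots s" for x :: real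
  proof -
    have "complex_of_real (poly (map_poly of_rat s) x) = poly (complex_poly s) (of_real x)"
      by (simp add: poly_altdef of_real_of_rat)
    then have "complex_of_real (poly (map_poly of_rat s) x) = 0"
      using that by simp
    then show ?thesis
      unfolding assms(5) by simp
  qed
  obtain v where v: "v \<noteq> 0" "f v = l *\<^sub>R v"
    by (rule eigenvector_exists[OF basis lin root[OF l(2)]])
  obtain w where w: "w \<noteq> 0" "f w = (1 / l) *\<^sub>R w"
    by (rule eigenvector_exists[OF basis lin root[OF l(3)]])
  have l2: "l \<noteq> 0" "l > 0" "l\<^sup>2 \<noteq> 1"
    using l(1) by (auto simp: power2_eq_1_iff)
  define v' where "v' = sgn (B v w) *\<^sub>R v"
  have v': "f v' = l *\<^sub>R v'"
    by (simp add: v'_def linear_scale[OF lin] v)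
  have vw: "B v' w > 0"
    using inverse_eigenvectors_not_orthogonal[OF v(2) w(2) l2(1,3) v(1) w(1)]
    by (simp add: v'_def form_simps sgn_mult_self_eq flip: abs_sgn) (simp add: sgn_if)
  have "degree s = degree (char_poly (matrix_wrt bs f))"
    unfolding assms(5) by simp
  also have "\<dots> = length bs"
    using degree_monic_char_poly[of "matrix_wrt bs f" "length bs"] by (simp add: matrix_wrt_def)
  finally have rank: "degree s = length bs" .
  have det: "\<bar>Determinant.det (gram_matrix B bs)\<bar> > cmod (discr s)"
    using assms(7) norm_ge_zero[of "discr s"] by linarith
  have integral: "integral_lattice N B"
    using assms(2) by (simp add: hyperbolic_lattice_def)
  show ?thesis
    by (rule chamber_through_axis[OF iso assms(4) l2(2,3) v' w(2) vw
          root_does_not_separate_axis[OF assms(3) integral assms(4) iso min rank l unit norm v' w(2) vw det]])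
qed

end
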